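(* Assume the kernel $K$ satisfies the lag-kernel assumption stated in the context, and let $\mathcal R:L^2(-\infty,T;E)\to L^2(0,T;F)$ be the bounded linear operator $$(\mathcal RZ)(t)=\int_0^{+\infty}K(t,\theta)Z(t-\theta)\,\alpha(d\theta),\qquad t\in[0,T].$$ Then its Hilbert adjoint $\mathcal R^*:L^2(0,T;F)\to L^2(-\infty,T;E)$ is given by $$(\mathcal R^*Q)(u)=\int_0^{+\infty}K(u+\theta,\theta)^*Q(u+\theta)\mathbf 1_{[0,T]}(u+\theta)\,\alpha(d\theta)$$ for almost every $u\in(-\infty,T]$. Moreover, $$\|\mathcal R^*Q\|^2_{L^2(-\infty,T;E)}\leqslant M_0M\,\|Q\|^2_{L^2(0,T;F)},\qquad Q\in L^2(0,T;F).$$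
   Context: $T>0$, $\lambda>0$ are fixed; $E,F$ are separable Hilbert spaces; $\alpha$ is a finite signed Borel measure on $[0,+\infty)$ with total variation $|\alpha|$. $L^2(I;E)$ is the usual space of (classes of) square integrable $E$-valued functions. Integrals against $\alpha$ are Bochner integrals. $C_\lambda((-\infty,T];E)$ is the space of continuous $x:(-\infty,T]\to E$ with $\|x\|_{\lambda,T}:=\sup_{s\leqslant T}e^{\lambda s}\|x(s)\|_E<\infty$ and $\lim_{s\to-\infty}e^{\lambda s}x(s)=0$. For $t\in[0,T]$, $x_t(s):=x(s)$ for $s\leqslant t$, $x_t(s):=x(t)$ for $t<s\leqslant T$, and $C_{\lambda,t}((-\infty,T];E):=\{x_t:x\in C_\lambda((-\infty,T];E)\}$. Non-anticipative path derivative: a measurable $a:[0,T]\times C_\lambda((-\infty,T];E)\to F$ is non-anticipatively differentiable at $(t,x)$ if there is a bounded linear operator $\partial_xa(t,x)\in\mathcal L(C_{\lambda,t}((-\infty,T];E),F)$ with $a(t,x+h)-a(t,x)-\partial_xa(t,x)h=o(\|h\|_{\lambda,T})$ as $\|h\|_{\lambda,T}\to0$, $h\in C_{\lambda,t}((-\infty,T];E)$. Lag-kernel assumption: for such an $a$, a fixed reference path $x\in C_\lambda((-\infty,T];E)$ and $\rho_t:=\partial_xa(t,x)$, $t\in[0,T]$, there exists a kernel $K:[0,T]\times[0,+\infty)\to\mathcal L(E,F)$ such that (i) for every $e\in E$, $(t,\theta)\mapsto K(t,\theta)e$ is jointly measurable; (ii) for every $t\in[0,T]$ and $h\in C_{\lambda,t}((-\infty,T];E)$,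 $\rho_t(h)=\int_0^{+\infty}K(t,\theta)h(t-\theta)\,\alpha(d\theta)$; (iii) the constants $M_0:=\sup_{t\in[0,T]}\int_0^{+\infty}\|K(t,\theta)\|_{\mathcal L(E,F)}|\alpha|(d\theta)$ and $M:=\sup_{u\in(-\infty,T]}\int_0^{+\infty}\|K(u+\theta,\theta)\|_{\mathcal L(E,F)}\mathbf 1_{[0,T]}(u+\theta)|\alpha|(d\theta)$ are finite. Expressions containing the factor $\mathbf 1_{[0,T]}(u+\theta)$ are understood to vanish when $u+\theta\notin[0,T]$. *)

theory Defs
  imports "HOL-Analysis.Analysis"
begin

section \<open>Finite signed measures\<close>

text \<open>A finite signed measure on the measurable space underlying \<open>M\<close> (only \<open>space M\<close> and \<open>sets M\<close>
  matter). Finiteness is automatic because the values are real.\<close>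

definition signed_measure :: "'a measure \<Rightarrow> ('a set \<Rightarrow> real) \<Rightarrow> bool" where
  "signed_measure M \<nu> \<longleftrightarrow>
     \<nu> {} = 0 \<and>
     (\<forall>A :: nat \<Rightarrow> 'a set. range A \<subseteq> sets M \<longrightarrow> disjoint_family A \<longrightarrow>
        (\<lambda>n. \<nu> (A n)) sums \<nu> (\<Union>n. A n))"

definition total_variation :: "'a measure \<Rightarrow> ('a set \<Rightarrow> real) \<Rightarrow> 'a set \<Rightarrow> ennreal" where
  "total_variation M \<nu> A =
     (SUP P \<in> {P. finite P \<and> P \<subseteq> sets M \<and> partition_on A P}. \<Sum>B\<in>P. ennreal \<bar>\<nu> B\<bar>)"

definition tv_measure :: "'a measure \<Rightarrow> ('a set \<Rightarrow> real) \<Rightarrow> 'a measure" where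
  "tv_measure M \<nu> = measure_of (space M) (sets M) (total_variation M \<nu>)"

text \<open>Jordan decomposition \<open>\<nu> = \<nu>\<^sup>+ - \<nu>\<^sup>-\<close> with \<open>\<nu>\<^sup>\<plusminus> = (\<bar>\<nu>\<bar> \<plusminus> \<nu>) / 2\<close>.\<close>

definition pos_part_measure :: "'a measure \<Rightarrow> ('a set \<Rightarrow> real) \<Rightarrow> 'a measure" where
  "pos_part_measure M \<nu> = measure_of (space M) (sets M)
     (\<lambda>A. ennreal ((enn2real (total_variation M \<nu> A) + \<nu> A) / 2))"

definition neg_part_measure :: "'a measure \<Rightarrow> ('a set \<Rightarrow> real) \<Rightarrow> 'a measure" where
  "neg_part_measure M \<nu> = measure_of (space M) (sets M)
     (\<lambda>A. ennreal ((enn2real (total_variation M \<nu> A) - \<nu> A) / 2))"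

text \<open>The Bochner integral against a signed measure. It is meaningful if \<open>f\<close> is Bochner
  integrable with respect to \<open>\<bar>\<nu>\<bar>\<close>, i.e. \<open>integrable (tv_measure M \<nu>) f\<close>, which is stated
  separately wherever the integral is used.\<close>

definition signed_integral ::
    "'a measure \<Rightarrow> ('a set \<Rightarrow> real) \<Rightarrow> ('a \<Rightarrow> 'b::{banach, second_countable_topology}) \<Rightarrow> 'b" where
  "signed_integral M \<nu> f =
     integral\<^sup>L (pos_part_measure M \<nu>) f - integral\<^sup>L (neg_part_measure M \<nu>) f"

abbreviation half_line :: "real measure" where
  "half_line \<equiv> restrict_space borel {0..}"


section \<open>Square integrable functions\<close>

text \<open>Elements of \<open>L\<^sup>2(M;E)\<close> are represented by Borel functions. An operator between \<open>L\<^sup>2\<close> spaces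
  is a map on representatives that is compatible with equality almost everywhere; equations
  between classes become equations almost everywhere.\<close>

definition L2_space :: "'a measure \<Rightarrow> ('a \<Rightarrow> 'b::real_inner) set" where
  "L2_space M = {f \<in> borel_measurable M. integrable M (\<lambda>x. (norm (f x))\<^sup>2)}"

definition L2_inner :: "'a measure \<Rightarrow> ('a \<Rightarrow> 'b::real_inner) \<Rightarrow> ('a \<Rightarrow> 'b) \<Rightarrow> real" where
  "L2_inner M f g = (LINT x|M. f x \<bullet> g x)"

definition L2_norm :: "'a measure \<Rightarrow> ('a \<Rightarrow> 'b::real_inner) \<Rightarrow> real" where
  "L2_norm M f = sqrt (LINT x|M. (norm (f x))\<^sup>2)"

definition L2_bounded_linear :: "'a measure \<Rightarrow> 'c measure \<Rightarrow>
    (('a \<Rightarrow> 'b::real_inner) \<Rightarrow> 'c \<Rightarrow> 'd::real_inner) \<Rightarrow> bool" where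
  "L2_bounded_linear M N A \<longleftrightarrow>
     (\<forall>f\<in>L2_space M. A f \<in> L2_space N) \<and>
     (\<forall>f\<in>L2_space M. \<forall>g\<in>L2_space M.
        (AE x in M. f x = g x) \<longrightarrow> (AE y in N. A f y = A g y)) \<and>
     (\<forall>f\<in>L2_space M. \<forall>g\<in>L2_space M. AE y in N. A (\<lambda>x. f x + g x) y = A f y + A g y) \<and>
     (\<forall>c. \<forall>f\<in>L2_space M. AE y in N. A (\<lambda>x. c *\<^sub>R f x) y = c *\<^sub>R A f y) \<and>
     (\<exists>C. \<forall>f\<in>L2_space M. L2_norm N (A f) \<le> C * L2_norm M f)"

definition is_L2_adjoint :: "'a measure \<Rightarrow> 'c measure \<Rightarrow>
    (('a \<Rightarrow> 'b::real_inner) \<Rightarrow> 'c \<Rightarrow> 'd::real_inner) \<Rightarrow> (('c \<Rightarrow> 'd) \<Rightarrow> 'a \<Rightarrow> 'b) \<Rightarrow> bool" where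
  "is_L2_adjoint M N A B \<longleftrightarrow>
     L2_bounded_linear N M B \<and>
     (\<forall>f\<in>L2_space M. \<forall>g\<in>L2_space N. L2_inner N (A f) g = L2_inner M f (B g))"

abbreviation past :: "real \<Rightarrow> real measure" where
  "past T \<equiv> restrict_space lborel {..T}"

abbreviation horizon :: "real \<Rightarrow> real measure" where
  "horizon T \<equiv> restrict_space lborel {0..T}"


section \<open>Weighted path space and non-anticipative derivative\<close>

text \<open>A path on \<open>(-\<infinity>, T]\<close> is represented by its extension to \<open>\<real>\<close> that is constant after \<open>T\<close>;
  this makes the path space a set of functions closed under pointwise operations.\<close>

definition path_space :: "real \<Rightarrow> real \<Rightarrow> (real \<Rightarrow> 'e::real_normed_vector) set" where
  "path_space lam T = {x.
     continuous_on {..T} x \<and> (\<forall>s>T. x s = x T) \<and>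
     bdd_above ((\<lambda>s. exp (lam * s) * norm (x s)) ` {..T}) \<and>
     ((\<lambda>s. exp (lam * s) *\<^sub>R x s) \<longlongrightarrow> 0) at_bot}"

definition path_norm :: "real \<Rightarrow> real \<Rightarrow> (real \<Rightarrow> 'e::real_normed_vector) \<Rightarrow> real" where
  "path_norm lam T x = (SUP s\<in>{..T}. exp (lam * s) * norm (x s))"

definition stopped :: "real \<Rightarrow> (real \<Rightarrow> 'e) \<Rightarrow> real \<Rightarrow> 'e" where
  "stopped t x = (\<lambda>s. if s \<le> t then x s else x t)"

definition stopped_path_space :: "real \<Rightarrow> real \<Rightarrow> real \<Rightarrow> (real \<Rightarrow> 'e::real_normed_vector) set" where
  "stopped_path_space lam T t = stopped t ` path_space lam T"

definition path_borel :: "real \<Rightarrow> real \<Rightarrow> (real \<Rightarrow> 'e::real_normed_vector) measure" where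
  "path_borel lam T = sigma (path_space lam T)
     {U. U \<subseteq> path_space lam T \<and>
         (\<forall>x\<in>U. \<exists>r>0. \<forall>y\<in>path_space lam T. path_norm lam T (\<lambda>s. y s - x s) < r \<longrightarrow> y \<in> U)}"

text \<open>\<open>D\<close> is the bounded linear operator \<open>\<partial>\<^sub>x a(t,x)\<close>; only its values on the subspace of paths
  stopped at \<open>t\<close> are relevant.\<close>

definition has_nonanticipative_derivative :: "real \<Rightarrow> real \<Rightarrow>
    (real \<Rightarrow> (real \<Rightarrow> 'e::real_normed_vector) \<Rightarrow> 'f::real_normed_vector) \<Rightarrow>
    real \<Rightarrow> (real \<Rightarrow> 'e) \<Rightarrow> ((real \<Rightarrow> 'e) \<Rightarrow> 'f) \<Rightarrow> bool" where
  "has_nonanticipative_derivative lam T a t x D \<longleftrightarrow>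
     (\<forall>h\<in>stopped_path_space lam T t. \<forall>k\<in>stopped_path_space lam T t.
        D (\<lambda>s. h s + k s) = D h + D k) \<and>
     (\<forall>c. \<forall>h\<in>stopped_path_space lam T t. D (\<lambda>s. c *\<^sub>R h s) = c *\<^sub>R D h) \<and>
     (\<exists>C. \<forall>h\<in>stopped_path_space lam T t. norm (D h) \<le> C * path_norm lam T h) \<and>
     (\<forall>\<epsilon>>0. \<exists>\<delta>>0. \<forall>h\<in>stopped_path_space lam T t. path_norm lam T h < \<delta> \<longrightarrow>
        norm (a t (\<lambda>s. x s + h s) - a t x - D h) \<le> \<epsilon> * path_norm lam T h)"


section \<open>Lag kernels\<close>

definition lag_M0 :: "real \<Rightarrow> (real set \<Rightarrow> real) \<Rightarrow>
    (real \<Rightarrow> real \<Rightarrow> 'e::real_normed_vector \<Rightarrow>\<^sub>L 'f::real_normed_vector) \<Rightarrow> ennreal" where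
  "lag_M0 T \<alpha> K = (SUP t\<in>{0..T}. \<integral>\<^sup>+\<theta>. ennreal (norm (K t \<theta>)) \<partial>tv_measure half_line \<alpha>)"

definition lag_M :: "real \<Rightarrow> (real set \<Rightarrow> real) \<Rightarrow>
    (real \<Rightarrow> real \<Rightarrow> 'e::real_normed_vector \<Rightarrow>\<^sub>L 'f::real_normed_vector) \<Rightarrow> ennreal" where
  "lag_M T \<alpha> K = (SUP u\<in>{..T}.
     \<integral>\<^sup>+\<theta>. ennreal (norm (K (u + \<theta>) \<theta>)) * indicator {0..T} (u + \<theta>) \<partial>tv_measure half_line \<alpha>)"

text \<open>\<open>K\<close> is only relevant on \<open>[0,T] \<times> [0,\<infinity>)\<close>; its values elsewhere are unconstrained.\<close>

definition lag_kernel :: "real \<Rightarrow> real \<Rightarrow> (real set \<Rightarrow> real) \<Rightarrow>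
    (real \<Rightarrow> (real \<Rightarrow> 'e) \<Rightarrow> 'f) \<Rightarrow> (real \<Rightarrow> 'e) \<Rightarrow> (real \<Rightarrow> (real \<Rightarrow> 'e) \<Rightarrow> 'f) \<Rightarrow>
    (real \<Rightarrow> real \<Rightarrow> 'e::{real_inner, banach, second_countable_topology}
       \<Rightarrow>\<^sub>L 'f::{real_inner, banach, second_countable_topology}) \<Rightarrow> bool" where
  "lag_kernel lam T \<alpha> a x \<rho> K \<longleftrightarrow>
     (\<lambda>(t, y). a t y) \<in> borel_measurable (restrict_space borel {0..T} \<Otimes>\<^sub>M path_borel lam T) \<and>
     x \<in> path_space lam T \<and>
     (\<forall>t\<in>{0..T}. has_nonanticipative_derivative lam T a t x (\<rho> t)) \<and>
     (\<forall>e. (\<lambda>(t, \<theta>). blinfun_apply (K t \<theta>) e)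
        \<in> borel_measurable (restrict_space borel {0..T} \<Otimes>\<^sub>M half_line)) \<and>
     (\<forall>t\<in>{0..T}. \<forall>h\<in>stopped_path_space lam T t.
        integrable (tv_measure half_line \<alpha>) (\<lambda>\<theta>. blinfun_apply (K t \<theta>) (h (t - \<theta>))) \<and>
        \<rho> t h = signed_integral half_line \<alpha> (\<lambda>\<theta>. blinfun_apply (K t \<theta>) (h (t - \<theta>)))) \<and>
     lag_M0 T \<alpha> K < \<infinity> \<and> lag_M T \<alpha> K < \<infinity>"

definition lag_operator :: "(real set \<Rightarrow> real) \<Rightarrow>
    (real \<Rightarrow> real \<Rightarrow> 'e::real_normed_vector \<Rightarrow>\<^sub>L 'f::{banach, second_countable_topology}) \<Rightarrow>
    (real \<Rightarrow> 'e) \<Rightarrow> real \<Rightarrow> 'f" where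
  "lag_operator \<alpha> K Z = (\<lambda>t. signed_integral half_line \<alpha> (\<lambda>\<theta>. blinfun_apply (K t \<theta>) (Z (t - \<theta>))))"

end

theory Submission
  imports Defs
begin

text \<open>By polar decomposition with respect to \<open>\<bar>\<alpha>\<bar>\<close>, an integral against \<open>\<alpha>\<close> is an integral of a function
  with a density bounded by \<open>1\<close> against the finite measure \<open>\<bar>\<alpha>\<bar>\<close>. The Cauchy-Schwarz inequality with
  weight \<open>\<parallel>K(t,\<theta>)\<parallel>\<close>, Tonelli's theorem and the substitution \<open>u = t - \<theta>\<close> give the Schur test
  \<open>\<parallel>R Z\<parallel>\<^sup>2 \<le> M\<^sub>0 M \<parallel>Z\<parallel>\<^sup>2\<close>. The kernel \<open>K(u + \<theta>, \<theta>)\<^sup>*\<close> satisfies the same hypotheses with the two constants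
  exchanged, so the claimed formula defines a bounded operator with the same bound. Fubini's theorem
  and the same substitution show that it is dual to \<open>R\<close>, and adjoints are unique almost everywhere.\<close>

section \<open>The total variation measure\<close>

text \<open>The kernel is measurable only vector by vector, as \<open>K t \<theta> e\<close> for
  fixed \<open>e\<close>, and bounded operators under the operator norm are in general not
  separable. Measurability of \<open>norm (K t \<theta>)\<close>, of
  \<open>K t \<theta> (Z (t - \<theta>))\<close> and of the adjoint kernel therefore has to be
  recovered from separability of the two Hilbert spaces.

  Three constants carry no information until an existence statement is proved:
  \<open>measure_of\<close> returns the zero measure unless its set function is a measure,
  \<open>enn2real\<close> sends an infinite variation to 0, and \<open>adjoint\<close> is a choice
  that satisfies the adjoint equation only if some map does. Hence the countable additivity and
  finiteness of the total variation, and the Riesz theorem.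

  All estimates are made on the whole line: functions are extended by zero and the kernel is cut off
  outside [0,T]. The substitution is then a plain translation of Lebesgue measure without endpoints,
  and \<alpha> enters only through a shift function, so that one locale serves the operator and its
  adjoint.\<close>

context
  fixes M :: "'a measure" and \<nu> :: "'a set \<Rightarrow> real"
  assumes sm: "signed_measure M \<nu>"
begin

lemma signed_measure_empty: "\<nu> {} = 0"
  using sm by (simp add: signed_measure_def)

lemma signed_measure_sums:
  fixes A :: "nat \<Rightarrow> 'a set"
  assumes "range A \<subseteq> sets M" "disjoint_family A"
  shows "(\<lambda>n. \<nu> (A n)) sums \<nu> (\<Union>n. A n)"
  using sm assms unfolding signed_measure_def by blast

lemma signed_measure_Un:
  assumes "A \<in> sets M" "B \<in> sets M" "A \<inter> B = {}"
  shows "\<nu> (A \<union> B) = \<nu> A + \<nu> B"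
proof -
  have "disjoint_family (binaryset A B)"
    using assms by (auto simp: disjoint_family_on_def binaryset_def)
  then have "(\<lambda>n. \<nu> (binaryset A B n)) sums \<nu> (\<Union>n. binaryset A B n)"
    using assms by (intro signed_measure_sums) (simp_all add: range_binaryset_eq)
  then have "(\<lambda>n. \<nu> (binaryset A B n)) sums \<nu> (A \<union> B)"
    by (simp add: UN_binaryset_eq)
  then show ?thesis
    using binaryset_sums[of \<nu> A B] signed_measure_empty sums_unique2 by blast
qed

lemma signed_measure_Union:
  assumes "finite P" "P \<subseteq> sets M" "disjoint P"
  shows "\<nu> (\<Union>P) = (\<Sum>B\<in>P. \<nu> B)"
  using assms
proof (induction P)
  case empty
  then show ?case by (simp add: signed_measure_empty)
next
  case (insert B P)
  have "B \<inter> \<Union>P = {}"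
    using insert.prems insert.hyps by (auto simp: disjoint_def)
  moreover have "\<Union>P \<in> sets M"
    using insert by (auto intro!: sets.finite_Union)
  ultimately show ?case
    using insert signed_measure_Un[of B "\<Union>P"] by (simp add: pairwise_insert)
qed

text \<open>A disjoint family that does not cover \<open>A\<close> is completed to a partition by
  the leftover \<open>A - \<Union>P\<close>; this can only increase the sum. The empty set is
  removed because \<open>partition_on\<close> forbids empty blocks, and it contributes 0.\<close>

lemma sum_le_total_variation:
  assumes "finite P" "P \<subseteq> sets M" "disjoint P" "\<Union>P \<subseteq> A" "A \<in> sets M"
  shows "(\<Sum>B\<in>P. ennreal \<bar>\<nu> B\<bar>) \<le> total_variation M \<nu> A"
proof -
  define P' where "P' = insert (A - \<Union>P) P - {{}}"
  have fin: "finite P'"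
    using assms by (simp add: P'_def)
  have "\<Union>P \<in> sets M"
    using assms by (auto intro!: sets.finite_Union)
  then have sub: "P' \<subseteq> sets M"
    using assms by (auto simp: P'_def)
  have "disjoint (insert (A - \<Union>P) P)"
    using assms(3) by (simp add: pairwise_insert disjnt_def) blast
  then have "disjoint P'"
    by (rule pairwise_subset) (auto simp: P'_def)
  moreover have "\<Union>P' = A"
    using assms(4) by (auto simp: P'_def)
  ultimately have "partition_on A P'"
    by (auto simp: partition_on_def P'_def)
  then have "(\<Sum>B\<in>P'. ennreal \<bar>\<nu> B\<bar>) \<le> total_variation M \<nu> A"
    unfolding total_variation_def using fin sub
    by (intro SUP_upper[of P' _ "\<lambda>P. \<Sum>B\<in>P. ennreal \<bar>\<nu> B\<bar>"]) simp
  moreover have "(\<Sum>B\<in>P. ennreal \<bar>\<nu> B\<bar>) = (\<Sum>B\<in>P - {{}}. ennreal \<bar>\<nu> B\<bar>)"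
    by (rule sum.mono_neutral_right) (use assms(1) in \<open>auto simp: signed_measure_empty\<close>)
  moreover have "\<dots> \<le> (\<Sum>B\<in>P'. ennreal \<bar>\<nu> B\<bar>)"
    by (rule sum_mono2) (use fin in \<open>auto simp: P'_def\<close>)
  ultimately show ?thesis by order
qed

lemma abs_le_total_variation:
  assumes "A \<in> sets M"
  shows "ennreal \<bar>\<nu> A\<bar> \<le> total_variation M \<nu> A"
  using sum_le_total_variation[of "{A}" A] assms by simp

lemma total_variation_empty: "total_variation M \<nu> {} = 0"
  unfolding total_variation_def by (intro antisym SUP_least) 
    (auto simp: partition_on_def intro!: sum.neutral signed_measure_empty)

text \<open>A partition of \<open>A\<close> and one of \<open>B\<close> together partition the
  union, so every pair of competitors on the left yields a competitor on the right.\<close>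

lemma total_variation_superadditive:
  assumes A: "A \<in> sets M" and B: "B \<in> sets M" and AB: "A \<inter> B = {}"
  shows "total_variation M \<nu> A + total_variation M \<nu> B \<le> total_variation M \<nu> (A \<union> B)"
proof -
  define \<P> where "\<P> C = {P. finite P \<and> P \<subseteq> sets M \<and> partition_on C P}" for C
  define v where "v P = (\<Sum>B\<in>P. ennreal \<bar>\<nu> B\<bar>)" for P
  have tv: "total_variation M \<nu> C = (SUP P\<in>\<P> C. v P)" for C
    by (simp add: total_variation_def \<P>_def v_def)
  \<comment> \<open>A sum of two suprema is a supremum of sums only over nonempty index sets.
    Removing the empty set lets the one-block partition cover \<open>C = {}\<close> as well.\<close>
  have ne: "\<P> C \<noteq> {}" if "C \<in> sets M" for C
  proof -
    have "{C} - {{}} \<in> \<P> C"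
      using that by (auto simp: \<P>_def partition_on_def disjoint_def)
    then show ?thesis by blast
  qed
  have "v P + v Q \<le> total_variation M \<nu> (A \<union> B)" if P: "P \<in> \<P> A" and Q: "Q \<in> \<P> B" for P Q
  proof -
    have "\<Union>P = A" "\<Union>Q = B" "{} \<notin> P"
      using P Q by (auto simp: \<P>_def partition_on_def)
    \<comment> \<open>A common block would lie in \<open>A \<inter> B\<close> and so be empty, which
      a partition excludes; hence no block is counted twice.\<close>
    then have "P \<inter> Q = {}"
      using AB by (metis Int_emptyI Sup_upper inf.bounded_iff subset_empty)
    then have "v P + v Q = v (P \<union> Q)"
      using P Q by (simp add: v_def \<P>_def sum.union_disjoint)
    also have "\<dots> \<le> total_variation M \<nu> (A \<union> B)"
      unfolding v_def
    proof (rule sum_le_total_variation)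
      show "disjoint (P \<union> Q)"
        using P Q AB by (intro disjoint_union) (auto simp: \<P>_def partition_on_def)
    qed (use P Q A B in \<open>auto simp: \<P>_def partition_on_def\<close>)
    finally show ?thesis .
  qed
  then have "(SUP P\<in>\<P> A. SUP Q\<in>\<P> B. v P + v Q) \<le> total_variation M \<nu> (A \<union> B)"
    by (intro SUP_least)
  also have "(SUP P\<in>\<P> A. SUP Q\<in>\<P> B. v P + v Q) = (SUP P\<in>\<P> A. v P) + (SUP Q\<in>\<P> B. v Q)"
    using ne A B by (simp add: ennreal_SUP_add_left flip: ennreal_SUP_add_right)
  finally show ?thesis by (simp add: tv)
qed

lemma total_variation_mono:
  assumes "A \<in> sets M" "B \<in> sets M" "A \<subseteq> B"
  shows "total_variation M \<nu> A \<le> total_variation M \<nu> B"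
proof -
  have "total_variation M \<nu> A \<le> total_variation M \<nu> A + total_variation M \<nu> (B - A)"
    by simp
  also have "\<dots> \<le> total_variation M \<nu> (A \<union> (B - A))"
    using assms by (intro total_variation_superadditive) auto
  also have "A \<union> (B - A) = B"
    using assms by auto
  finally show ?thesis .
qed

lemma sum_total_variation_le:
  fixes A :: "nat \<Rightarrow> 'a set"
  assumes "range A \<subseteq> sets M" "disjoint_family A"
  shows "(\<Sum>i<n. total_variation M \<nu> (A i)) \<le> total_variation M \<nu> (\<Union>i<n. A i)"
proof (induction n)
  case (Suc n)
  have "A i \<inter> A n = {}" if "i < n" for i
    using disjoint_family_onD[OF assms(2), of i n] that by simp
  then have disj: "(\<Union>i<n. A i) \<inter> A n = {}"
    by auto
  have "(\<Sum>i<Suc n. total_variation M \<nu> (A i))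
      \<le> total_variation M \<nu> (\<Union>i<n. A i) + total_variation M \<nu> (A n)"
    using Suc by (simp add: add_right_mono)
  also have "\<dots> \<le> total_variation M \<nu> ((\<Union>i<n. A i) \<union> A n)"
    using assms disj by (intro total_variation_superadditive) auto
  also have "(\<Union>i<n. A i) \<union> A n = (\<Union>i<Suc n. A i)"
    by (auto simp: less_Suc_eq)
  finally show ?case .
qed (simp add: total_variation_empty)

end

text \<open>The triangle inequality for series requires absolute convergence; if it fails, the
  right-hand side is infinite.\<close>

lemma ennreal_abs_sums_le:
  fixes f :: "nat \<Rightarrow> real"
  assumes "f sums s"
  shows "ennreal \<bar>s\<bar> \<le> (\<Sum>i. ennreal \<bar>f i\<bar>)"
proof (cases "(\<Sum>i. ennreal \<bar>f i\<bar>) = top")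
  case False
  then have summ: "summable (\<lambda>i. \<bar>f i\<bar>)"
    by (intro summable_suminf_not_top) auto
  have "\<bar>s\<bar> \<le> (\<Sum>i. \<bar>f i\<bar>)"
    using summable_rabs[OF summ] assms by (simp add: sums_iff)
  then show ?thesis
    by (subst suminf_ennreal2[OF _ summ]) (auto intro: ennreal_leI)
qed simp

section \<open>Countable additivity and finiteness of the total variation\<close>

context
  fixes M :: "'a measure" and \<nu> :: "'a set \<Rightarrow> real"
  assumes sm: "signed_measure M \<nu>"
begin

text \<open>One inequality is superadditivity for the partial sums. For the other, every block of a
  partition of the union is cut along the sets \<open>A i\<close>: countable additivity of
  \<open>\<nu>\<close> bounds the block by the sum over its pieces, and for fixed \<open>i\<close>
  the pieces are disjoint subsets of \<open>A i\<close>.\<close>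

lemma total_variation_countably_additive:
  "countably_additive (sets M) (total_variation M \<nu>)"
proof (rule countably_additiveI)
  fix A :: "nat \<Rightarrow> 'a set"
  assume A: "range A \<subseteq> sets M" "disjoint_family A" "(\<Union>i. A i) \<in> sets M"
  show "(\<Sum>i. total_variation M \<nu> (A i)) = total_variation M \<nu> (\<Union>i. A i)"
  proof (rule antisym)
    have "(\<Sum>i<n. total_variation M \<nu> (A i)) \<le> total_variation M \<nu> (\<Union>i. A i)" for n
      using A by (intro order.trans[OF sum_total_variation_le[OF sm]] total_variation_mono[OF sm]) auto
    then show "(\<Sum>i. total_variation M \<nu> (A i)) \<le> total_variation M \<nu> (\<Union>i. A i)"
      by (simp add: suminf_eq_SUP SUP_least)
  next
    have "(\<Sum>B\<in>P. ennreal \<bar>\<nu> B\<bar>) \<le> (\<Sum>i. total_variation M \<nu> (A i))"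
      if P: "finite P" "P \<subseteq> sets M" "partition_on (\<Union>i. A i) P" for P
    proof -
      have "ennreal \<bar>\<nu> B\<bar> \<le> (\<Sum>i. ennreal \<bar>\<nu> (B \<inter> A i)\<bar>)" if "B \<in> P" for B
      proof -
        have "B = (\<Union>i. B \<inter> A i)"
          using that P(3) by (auto simp: partition_on_def)
        moreover have "range (\<lambda>i. B \<inter> A i) \<subseteq> sets M"
          using that P A by auto
        moreover have "disjoint_family (\<lambda>i. B \<inter> A i)"
          using A by (auto simp: disjoint_family_on_def)
        ultimately have "(\<lambda>i. \<nu> (B \<inter> A i)) sums \<nu> B"
          using signed_measure_sums[OF sm, of "\<lambda>i. B \<inter> A i"] by simp
        then show ?thesis by (rule ennreal_abs_sums_le)
      qed
      then have "(\<Sum>B\<in>P. ennreal \<bar>\<nu> B\<bar>) \<le> (\<Sum>B\<in>P. \<Sum>i. ennreal \<bar>\<nu> (B \<inter> A i)\<bar>)"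
        by (rule sum_mono)
      also have "\<dots> = (\<Sum>i. \<Sum>B\<in>P. ennreal \<bar>\<nu> (B \<inter> A i)\<bar>)"
        by (subst suminf_sum) auto
      also have "\<dots> \<le> (\<Sum>i. total_variation M \<nu> (A i))"
      proof (rule suminf_le)
        fix i
        have disj: "B \<inter> C = {}" if "B \<in> P" "C \<in> P" "B \<noteq> C" for B C
          using P(3) that by (auto simp: partition_on_def disjoint_def)
        \<comment> \<open>Two different blocks have the same trace on \<open>A i\<close> only if
          that trace is empty, where \<open>\<nu>\<close> vanishes. So replacing the blocks by the
          set of their traces leaves the sum unchanged.\<close>
        have "\<bar>\<nu> (B \<inter> A i)\<bar> = 0" if "B \<in> P" "C \<in> P" "B \<noteq> C" "B \<inter> A i = C \<inter> A i" for B C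
        proof -
          have "B \<inter> A i = {}"
            using disj[OF that(1-3)] that(4) by blast
          then show ?thesis
            using signed_measure_empty[OF sm] by simp
        qed
        then have "(\<Sum>B\<in>P. ennreal \<bar>\<nu> (B \<inter> A i)\<bar>) = (\<Sum>B\<in>(\<lambda>B. B \<inter> A i) ` P. ennreal \<bar>\<nu> B\<bar>)"
          using P(1) by (subst sum.reindex_nontrivial) auto
        also have "\<dots> \<le> total_variation M \<nu> (A i)"
        proof (rule sum_le_total_variation[OF sm])
          show "disjoint ((\<lambda>B. B \<inter> A i) ` P)"
            using disj by (auto simp: disjoint_def)
        qed (use P A in auto)
        finally show "(\<Sum>B\<in>P. ennreal \<bar>\<nu> (B \<inter> A i)\<bar>) \<le> total_variation M \<nu> (A i)" .
      qed auto
      finally show ?thesis .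
    qed
    then show "total_variation M \<nu> (\<Union>i. A i) \<le> (\<Sum>i. total_variation M \<nu> (A i))"
      unfolding total_variation_def[of M \<nu> "\<Union>i. A i"] by (intro SUP_least) auto
  qed
qed

lemma sets_tv_measure [simp, measurable_cong]: "sets (tv_measure M \<nu>) = sets M"
  and space_tv_measure [simp]: "space (tv_measure M \<nu>) = space M"
  by (simp_all add: tv_measure_def)

lemma emeasure_tv_measure:
  "A \<in> sets M \<Longrightarrow> emeasure (tv_measure M \<nu>) A = total_variation M \<nu> A"
  unfolding tv_measure_def
  by (rule emeasure_measure_of_sigma)
     (auto simp: sets.sigma_algebra_axioms positive_def total_variation_empty[OF sm]
       total_variation_countably_additive)

lemma total_variation_Un:
  assumes "A \<in> sets M" "B \<in> sets M" "A \<inter> B = {}"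
  shows "total_variation M \<nu> (A \<union> B) = total_variation M \<nu> A + total_variation M \<nu> B"
  using plus_emeasure[of A "tv_measure M \<nu>" B] assms by (simp add: emeasure_tv_measure)

text \<open>Iterating this split would produce disjoint sets whose measures do not tend to \<open>0\<close>.\<close>

lemma infinite_total_variation_split:
  assumes E: "E \<in> sets M" "total_variation M \<nu> E = \<infinity>"
  shows "\<exists>B\<in>sets M. B \<subseteq> E \<and> 1 < \<bar>\<nu> (E - B)\<bar> \<and> total_variation M \<nu> B = \<infinity>"
proof -
  \<comment> \<open>The factor 2 is lost when only the blocks of one sign are kept. Their union
    \<open>A\<close> then has \<open>\<bar>\<nu> A\<bar> > 1 + \<bar>\<nu> E\<bar>\<close>, so both
    \<open>A\<close> and \<open>E - A\<close> have absolute value above 1, and whichever of them has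
    infinite variation can serve as \<open>B\<close>.\<close>
  have "ennreal (2 * (1 + \<bar>\<nu> E\<bar>)) < total_variation M \<nu> E"
    using E by simp
  then obtain P where P: "finite P" "P \<subseteq> sets M" "partition_on E P"
      and less: "ennreal (2 * (1 + \<bar>\<nu> E\<bar>)) < (\<Sum>B\<in>P. ennreal \<bar>\<nu> B\<bar>)"
    unfolding total_variation_def less_SUP_iff by blast
  have *: "2 * (1 + \<bar>\<nu> E\<bar>) < (\<Sum>B\<in>P. \<bar>\<nu> B\<bar>)"
    using less by (simp add: sum_ennreal ennreal_less_iff del: ennreal_plus)
  define Pp Pn where "Pp = {B\<in>P. 0 \<le> \<nu> B}" and "Pn = {B\<in>P. \<nu> B < 0}"
  have disj: "disjoint P" and E_eq: "E = \<Union>P"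
    using P(3) by (auto simp: partition_on_def)
  have sum_Q: "\<nu> (\<Union>Q) = (\<Sum>B\<in>Q. \<nu> B)" "\<Union>Q \<in> sets M" if "Q \<subseteq> P" for Q
    using that P disj
    by (auto intro!: signed_measure_Union[OF sm] sets.finite_Union intro: finite_subset pairwise_subset)
  have "(\<Sum>B\<in>P. \<bar>\<nu> B\<bar>) = (\<Sum>B\<in>Pp. \<bar>\<nu> B\<bar>) + (\<Sum>B\<in>Pn. \<bar>\<nu> B\<bar>)"
    using P(1) by (subst sum.union_disjoint[symmetric]) (auto simp: Pp_def Pn_def intro!: sum.cong)
  also have "(\<Sum>B\<in>Pp. \<bar>\<nu> B\<bar>) = \<nu> (\<Union>Pp)"
    by (subst sum_Q) (auto simp: Pp_def intro!: sum.cong)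
  also have "(\<Sum>B\<in>Pn. \<bar>\<nu> B\<bar>) = - \<nu> (\<Union>Pn)"
    by (subst sum_Q) (auto simp: Pn_def simp flip: sum_negf intro!: sum.cong)
  finally have "1 + \<bar>\<nu> E\<bar> < \<bar>\<nu> (\<Union>Pp)\<bar> \<or> 1 + \<bar>\<nu> E\<bar> < \<bar>\<nu> (\<Union>Pn)\<bar>"
    using * by (smt (verit))
  then obtain Q where Q: "Q \<subseteq> P" "1 + \<bar>\<nu> E\<bar> < \<bar>\<nu> (\<Union>Q)\<bar>"
    using that[of Pp] that[of Pn] by (auto simp: Pp_def Pn_def)
  define A where "A = \<Union>Q"
  have A: "A \<in> sets M" "A \<subseteq> E" "1 + \<bar>\<nu> E\<bar> < \<bar>\<nu> A\<bar>"
    using Q sum_Q(2) by (auto simp: A_def E_eq)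
  have un: "A \<union> (E - A) = E"
    using A by auto
  have "\<nu> E = \<nu> A + \<nu> (E - A)"
    using signed_measure_Un[OF sm, of A "E - A"] A E un by auto
  then have big: "1 < \<bar>\<nu> (E - A)\<bar>" "1 < \<bar>\<nu> A\<bar>"
    using A by linarith+
  have "total_variation M \<nu> A + total_variation M \<nu> (E - A) = \<infinity>"
    using total_variation_Un[of A "E - A"] A E un by auto
  then consider "total_variation M \<nu> A = \<infinity>" | "total_variation M \<nu> (E - A) = \<infinity>"
    by auto
  then show ?thesis
  proof cases
    case 1
    then show ?thesis using A big by blast
  next
    case 2
    have "E - (E - A) = A"
      using A by auto
    then show ?thesis using 2 A E big by (intro bexI[of _ "E - A"]) auto
  qed
qed

lemma total_variation_finite: "total_variation M \<nu> (space M) < \<infinity>"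
proof (rule ccontr)
  assume "\<not> ?thesis"
  then have inf: "total_variation M \<nu> (space M) = \<infinity>"
    by (simp add: not_less top_unique)
  define I where "I E \<longleftrightarrow> E \<in> sets M \<and> total_variation M \<nu> E = \<infinity>" for E
  have "\<exists>E. \<forall>n. I (E n) \<and> (E (Suc n) \<subseteq> E n \<and> 1 < \<bar>\<nu> (E n - E (Suc n))\<bar>)"
  proof (rule dependent_nat_choice)
    show "\<exists>E. I E"
      using inf by (auto simp: I_def)
    show "\<exists>B. I B \<and> (B \<subseteq> E \<and> 1 < \<bar>\<nu> (E - B)\<bar>)" if "I E" for E n
      using infinite_total_variation_split[of E] that by (auto simp: I_def)
  qed
  then obtain E :: "nat \<Rightarrow> 'a set"
    where E: "\<And>n. I (E n)" "\<And>n. E (Suc n) \<subseteq> E n" "\<And>n. 1 < \<bar>\<nu> (E n - E (Suc n))\<bar>"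
    by blast
  have anti: "E n \<subseteq> E m" if "m \<le> n" for m n
    using lift_Suc_antimono_le[of E] E(2) that by blast
  have "(E m - E (Suc m)) \<inter> (E n - E (Suc n)) = {}" if "m < n" for m n
    using anti[of "Suc m" n] that by auto
  then have "disjoint_family (\<lambda>n. E n - E (Suc n))"
    unfolding disjoint_family_on_def by (metis Int_commute linorder_neqE_nat)
  moreover have "range (\<lambda>n. E n - E (Suc n)) \<subseteq> sets M"
    using E(1) by (auto simp: I_def)
  ultimately have "(\<lambda>n. \<nu> (E n - E (Suc n))) sums \<nu> (\<Union>n. E n - E (Suc n))"
    by (intro signed_measure_sums[OF sm])
  \<comment> \<open>Countable additivity includes convergence of the series to a real number, so its
    terms tend to 0, although each exceeds 1 in absolute value.\<close>
  then have "(\<lambda>n. \<nu> (E n - E (Suc n))) \<longlonglongrightarrow> 0"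
    using summable_LIMSEQ_zero sums_summable by blast
  then have "\<forall>\<^sub>F n in sequentially. norm (\<nu> (E n - E (Suc n))) < 1"
    using LIMSEQ_D[of _ 0 1] by (fastforce simp: eventually_sequentially)
  then show False
    using E(3) by (metis (no_types, lifting) eventually_sequentially less_asym order_refl real_norm_def)
qed

lemma finite_measure_tv_measure: "finite_measure (tv_measure M \<nu>)"
  using total_variation_finite by (intro finite_measureI) (auto simp: emeasure_tv_measure)

section \<open>The integral against a signed measure\<close>

lemma enn2real_total_variation:
  assumes "A \<in> sets M"
  shows "enn2real (total_variation M \<nu> A) = measure (tv_measure M \<nu>) A"
  using assms by (simp add: measure_def emeasure_tv_measure)

lemma abs_le_measure_tv_measure:
  assumes "A \<in> sets M"
  shows "\<bar>\<nu> A\<bar> \<le> measure (tv_measure M \<nu>) A"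
proof -
  interpret finite_measure "tv_measure M \<nu>"
    by (rule finite_measure_tv_measure)
  have "ennreal \<bar>\<nu> A\<bar> \<le> ennreal (measure (tv_measure M \<nu>) A)"
    using abs_le_total_variation[OF sm assms] assms emeasure_eq_measure[of A]
    by (simp add: emeasure_tv_measure)
  then show ?thesis
    by (simp add: ennreal_le_iff)
qed

text \<open>With \<open>c = \<plusminus>1\<close> the following covers the positive and the negative part.\<close>

lemma countably_additive_Jordan_part:
  assumes c: "\<bar>c\<bar> \<le> 1"
  shows "countably_additive (sets M)
    (\<lambda>A. ennreal ((enn2real (total_variation M \<nu> A) + c * \<nu> A) / 2))"
proof (rule countably_additiveI)
  interpret finite_measure "tv_measure M \<nu>"
    by (rule finite_measure_tv_measure)
  fix A :: "nat \<Rightarrow> 'a set"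
  assume A: "range A \<subseteq> sets M" "disjoint_family A" "(\<Union>i. A i) \<in> sets M"
  define g where "g B = (enn2real (total_variation M \<nu> B) + c * \<nu> B) / 2" for B
  \<comment> \<open>Since \<open>ennreal\<close> sends negative numbers to 0, additivity of the real
    set function carries over only where that function is nonnegative.\<close>
  have nonneg: "0 \<le> g B" if "B \<in> sets M" for B
  proof -
    have "\<bar>c * \<nu> B\<bar> \<le> 1 * \<bar>\<nu> B\<bar>"
      unfolding abs_mult using c by (intro mult_right_mono) auto
    then show ?thesis
      using abs_le_measure_tv_measure[OF that]
      by (simp add: g_def enn2real_total_variation[OF that])
  qed
  have "(\<lambda>i. measure (tv_measure M \<nu>) (A i)) sums measure (tv_measure M \<nu>) (\<Union>i. A i)"
    using A by (intro finite_measure_UNION) auto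
  moreover have "(\<lambda>i. \<nu> (A i)) sums \<nu> (\<Union>i. A i)"
    using A by (intro signed_measure_sums[OF sm])
  ultimately have "(\<lambda>i. (measure (tv_measure M \<nu>) (A i) + c * \<nu> (A i)) / 2) sums
      ((measure (tv_measure M \<nu>) (\<Union>i. A i) + c * \<nu> (\<Union>i. A i)) / 2)"
    by (intro sums_divide sums_add sums_mult)
  moreover have "g (A i) = (measure (tv_measure M \<nu>) (A i) + c * \<nu> (A i)) / 2" for i
    using A(1) by (auto simp: g_def enn2real_total_variation range_subsetD)
  moreover have "g (\<Union>i. A i) = (measure (tv_measure M \<nu>) (\<Union>i. A i) + c * \<nu> (\<Union>i. A i)) / 2"
    using A(3) by (simp add: g_def enn2real_total_variation)
  ultimately have "(\<lambda>i. g (A i)) sums g (\<Union>i. A i)"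
    by presburger
  then show "(\<Sum>i. ennreal (g (A i))) = ennreal (g (\<Union>i. A i))"
    using nonneg A by (intro suminf_ennreal_eq) (auto simp: range_subsetD)
qed

lemma sets_pos_part_measure [simp, measurable_cong]: "sets (pos_part_measure M \<nu>) = sets M"
  and space_pos_part_measure [simp]: "space (pos_part_measure M \<nu>) = space M"
  and sets_neg_part_measure [simp, measurable_cong]: "sets (neg_part_measure M \<nu>) = sets M"
  and space_neg_part_measure [simp]: "space (neg_part_measure M \<nu>) = space M"
  by (simp_all add: pos_part_measure_def neg_part_measure_def)

lemma emeasure_pos_part_measure:
  assumes "A \<in> sets M"
  shows "emeasure (pos_part_measure M \<nu>) A = ennreal ((measure (tv_measure M \<nu>) A + \<nu> A) / 2)"
proof -
  have "emeasure (pos_part_measure M \<nu>) A =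
      ennreal ((enn2real (total_variation M \<nu> A) + \<nu> A) / 2)"
    unfolding pos_part_measure_def
    using countably_additive_Jordan_part[of 1] assms
    by (intro emeasure_measure_of_sigma)
       (auto simp: sets.sigma_algebra_axioms positive_def total_variation_empty[OF sm]
         signed_measure_empty[OF sm])
  then show ?thesis using assms by (simp add: enn2real_total_variation)
qed

lemma emeasure_neg_part_measure:
  assumes "A \<in> sets M"
  shows "emeasure (neg_part_measure M \<nu>) A = ennreal ((measure (tv_measure M \<nu>) A - \<nu> A) / 2)"
proof -
  have "emeasure (neg_part_measure M \<nu>) A =
      ennreal ((enn2real (total_variation M \<nu> A) - \<nu> A) / 2)"
    unfolding neg_part_measure_def
    using countably_additive_Jordan_part[of "-1"] assms
    by (intro emeasure_measure_of_sigma)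
       (auto simp: sets.sigma_algebra_axioms positive_def total_variation_empty[OF sm]
         signed_measure_empty[OF sm])
  then show ?thesis using assms by (simp add: enn2real_total_variation)
qed

text \<open>\<open>p\<close> is the Radon-Nikodym density of the positive part with respect to the
  total variation, so that \<open>2 * p - 1\<close> is the sign in the polar decomposition. The
  bounds on \<open>p\<close> hold everywhere, which spares later estimates an exceptional
  set.\<close>

lemma Jordan_density:
  "\<exists>p \<in> borel_measurable M. (\<forall>x. 0 \<le> p x) \<and> (\<forall>x. p x \<le> (1::real)) \<and>
    pos_part_measure M \<nu> = density (tv_measure M \<nu>) (\<lambda>x. ennreal (p x)) \<and>
    neg_part_measure M \<nu> = density (tv_measure M \<nu>) (\<lambda>x. ennreal (1 - p x))"
proof -
  interpret finite_measure "tv_measure M \<nu>"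
    by (rule finite_measure_tv_measure)
  let ?\<mu> = "tv_measure M \<nu>"
  have le: "emeasure (pos_part_measure M \<nu>) A \<le> emeasure ?\<mu> A" if "A \<in> sets M" for A
    using abs_le_measure_tv_measure[OF that]
    by (simp add: emeasure_pos_part_measure[OF that] emeasure_eq_measure ennreal_leI)
  have "absolutely_continuous ?\<mu> (pos_part_measure M \<nu>)"
    unfolding absolutely_continuous_def null_sets_def
    using le by (auto intro: antisym[OF _ zero_le] simp: le_zero_eq[symmetric] simp del: le_zero_eq)
       (metis zero_le antisym)
  then obtain f where f[measurable]: "f \<in> borel_measurable ?\<mu>"
      and dens: "density ?\<mu> f = pos_part_measure M \<nu>"
    using Radon_Nikodym[of "pos_part_measure M \<nu>"] by auto
  have f1: "AE x in ?\<mu>. f x \<le> 1"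
  proof (rule AE_upper_bound_inf_ennreal)
    fix e :: real assume "e > 0"
    \<comment> \<open>On this set the density is at least \<open>1 + e\<close>, while the positive
      part is at most the total variation. Hence
      \<open>(1 + e) * measure ?\<mu> B \<le> measure ?\<mu> B\<close>, and finiteness forces
      \<open>B\<close> to be a null set.\<close>
    define B where "B = {x \<in> space M. f x \<ge> 1 + e}"
    have B[measurable]: "B \<in> sets ?\<mu>"
      unfolding B_def using f by measurable
    have "(1 + e) * emeasure ?\<mu> B = (\<integral>\<^sup>+x. ennreal (1 + e) * indicator B x \<partial>?\<mu>)"
      using \<open>e > 0\<close> B by (subst nn_integral_cmult_indicator) (simp_all add: ennreal_plus[symmetric])
    also have "\<dots> \<le> (\<integral>\<^sup>+x. f x * indicator B x \<partial>?\<mu>)"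
      using \<open>e > 0\<close> by (intro nn_integral_mono) (auto simp: B_def indicator_def)
    also have "\<dots> = emeasure (pos_part_measure M \<nu>) B"
      unfolding dens[symmetric] using f B by (rule emeasure_density[symmetric])
    also have "\<dots> \<le> emeasure ?\<mu> B"
      using le B by simp
    finally have "(1 + e) * measure ?\<mu> B \<le> measure ?\<mu> B"
      using \<open>e > 0\<close>
      by (simp add: emeasure_eq_measure ennreal_mult[symmetric] ennreal_1[symmetric] ennreal_plus[symmetric]
          del: ennreal_1 ennreal_plus)
    then have "e * measure ?\<mu> B \<le> 0"
      by (simp add: algebra_simps)
    then have "emeasure ?\<mu> B = 0"
      using \<open>e > 0\<close> by (simp add: emeasure_eq_measure mult_le_0_iff) (smt (verit) measure_nonneg)
    then have "AE x in ?\<mu>. x \<notin> B"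
      using B by (intro AE_not_in) (auto simp: null_sets_def)
    then show "AE x in ?\<mu>. f x \<le> 1 + ennreal e"
      using AE_space by eventually_elim (use \<open>e > 0\<close> in \<open>auto simp: B_def\<close>)
  qed
  \<comment> \<open>The truncation changes \<open>f\<close> only on a null set and makes it finite
    everywhere.\<close>
  define p where "p x = enn2real (min 1 (f x))" for x
  have p_le: "min 1 (f x) < top" "p x \<le> 1" "0 \<le> p x" for x
  proof -
    show "min 1 (f x) < top"
      by (simp add: min_less_iff_disj)
    show "p x \<le> 1"
      unfolding p_def by (rule enn2real_leI) auto
    show "0 \<le> p x"
      by (simp add: p_def)
  qed
  have p_meas[measurable]: "p \<in> borel_measurable M"
  proof -
    have "f \<in> borel_measurable M" using f by (simp cong: measurable_cong_sets)
    then show ?thesis unfolding p_def by measurable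
  qed
  have pos: "pos_part_measure M \<nu> = density ?\<mu> (\<lambda>x. ennreal (p x))"
    unfolding dens[symmetric]
    by (rule density_cong) (use f1 p_le(1) in \<open>auto simp: p_def min_absorb2\<close>)
  have neg: "neg_part_measure M \<nu> = density ?\<mu> (\<lambda>x. ennreal (1 - p x))"
  proof (rule measure_eqI)
    fix A assume "A \<in> sets (neg_part_measure M \<nu>)"
    then have A: "A \<in> sets M" "A \<in> sets ?\<mu>" by auto
    \<comment> \<open>Instead of subtracting extended reals, the positive part is added to both
      candidates; it can be cancelled afterwards because it is finite.\<close>
    have *: "emeasure (density ?\<mu> (\<lambda>x. ennreal (1 - p x))) A + emeasure (pos_part_measure M \<nu>) A
        = emeasure ?\<mu> A"
    proof -
      have "emeasure (density ?\<mu> (\<lambda>x. ennreal (1 - p x))) A + emeasure (pos_part_measure M \<nu>) A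
          = (\<integral>\<^sup>+x. ennreal (1 - p x) * indicator A x + ennreal (p x) * indicator A x \<partial>?\<mu>)"
        unfolding pos using A by (subst nn_integral_add) (auto simp: emeasure_density)
      also have "\<dots> = (\<integral>\<^sup>+x. indicator A x \<partial>?\<mu>)"
        using p_le by (intro nn_integral_cong)
          (auto simp: ennreal_plus[symmetric] indicator_def simp del: ennreal_plus)
      finally show ?thesis using A by simp
    qed
    have "emeasure (neg_part_measure M \<nu>) A + emeasure (pos_part_measure M \<nu>) A = emeasure ?\<mu> A"
      using abs_le_measure_tv_measure[OF A(1)]
      by (simp add: emeasure_pos_part_measure[OF A(1)] emeasure_neg_part_measure[OF A(1)]
          emeasure_eq_measure ennreal_plus[symmetric] field_simps del: ennreal_plus)
    with * have "emeasure (neg_part_measure M \<nu>) A + emeasure (pos_part_measure M \<nu>) A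
       = emeasure (density ?\<mu> (\<lambda>x. ennreal (1 - p x))) A + emeasure (pos_part_measure M \<nu>) A"
      by simp
    moreover have "emeasure (pos_part_measure M \<nu>) A \<noteq> top"
      by (simp add: emeasure_pos_part_measure[OF A(1)])
    ultimately show "emeasure (neg_part_measure M \<nu>) A = emeasure (density ?\<mu> (\<lambda>x. ennreal (1 - p x))) A"
      using ennreal_add_left_cancel[of "emeasure (pos_part_measure M \<nu>) A"
          "emeasure (neg_part_measure M \<nu>) A" "emeasure (density ?\<mu> (\<lambda>x. ennreal (1 - p x))) A"]
      by (simp only: add.commute simp_thms infinity_ennreal_def)
  qed simp
  show ?thesis
    by (intro bexI[of _ p] conjI allI p_meas p_le(2,3) pos neg)
qed

end

section \<open>Calculus of the signed integral: linearity, measurability, norm bound, Fubini\<close>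

context
  fixes M :: "'a measure" and \<nu> :: "'a set \<Rightarrow> real"
  assumes sm: "signed_measure M \<nu>"
begin

lemma borel_measurable_tv_measure: "borel_measurable (tv_measure M \<nu>) = borel_measurable M"
  using sm by (intro measurable_cong_sets) simp_all

lemma integrable_Jordan_parts:
  fixes f :: "'a \<Rightarrow> 'b::{banach, second_countable_topology}"
  assumes "integrable (tv_measure M \<nu>) f"
  shows "integrable (pos_part_measure M \<nu>) f" "integrable (neg_part_measure M \<nu>) f"
proof -
  obtain p where p: "p \<in> borel_measurable M" "\<And>x. 0 \<le> p x" "\<And>x. p x \<le> (1::real)"
    "pos_part_measure M \<nu> = density (tv_measure M \<nu>) (\<lambda>x. ennreal (p x))"
    "neg_part_measure M \<nu> = density (tv_measure M \<nu>) (\<lambda>x. ennreal (1 - p x))"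
    using Jordan_density[OF sm] by blast
  have [measurable]: "f \<in> borel_measurable (tv_measure M \<nu>)" "p \<in> borel_measurable (tv_measure M \<nu>)"
    using borel_measurable_integrable[OF assms] p(1) by (simp_all add: borel_measurable_tv_measure)
  have "norm (q *\<^sub>R v) \<le> norm v" if "0 \<le> q" "q \<le> 1" for q and v :: 'b
    using that by (simp add: mult_left_le_one_le)
  note le = this[OF p(2,3)] this[of "1 - p _"]
  have "integrable (tv_measure M \<nu>) (\<lambda>x. p x *\<^sub>R f x)"
    by (rule Bochner_Integration.integrable_bound[OF assms]) (use le in auto)
  then show "integrable (pos_part_measure M \<nu>) f"
    unfolding p(4) using p(2) by (subst integrable_density) auto
  have "integrable (tv_measure M \<nu>) (\<lambda>x. (1 - p x) *\<^sub>R f x)"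
    by (rule Bochner_Integration.integrable_bound[OF assms]) (use le p(2,3) in auto)
  then show "integrable (neg_part_measure M \<nu>) f"
    unfolding p(5) using p(3) by (subst integrable_density) auto
qed

lemma signed_integral_add:
  fixes f g :: "'a \<Rightarrow> 'b::{banach, second_countable_topology}"
  assumes "integrable (tv_measure M \<nu>) f" "integrable (tv_measure M \<nu>) g"
  shows "signed_integral M \<nu> (\<lambda>x. f x + g x) = signed_integral M \<nu> f + signed_integral M \<nu> g"
  unfolding signed_integral_def
  using integrable_Jordan_parts[OF assms(1)] integrable_Jordan_parts[OF assms(2)] by simp

lemma signed_integral_bounded_linear:
  fixes f :: "'a \<Rightarrow> 'b::{banach, second_countable_topology}"
    and T :: "'b \<Rightarrow> 'c::{banach, second_countable_topology}"
  assumes "bounded_linear T" "integrable (tv_measure M \<nu>) f"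
  shows "signed_integral M \<nu> (\<lambda>x. T (f x)) = T (signed_integral M \<nu> f)"
  unfolding signed_integral_def
  using integrable_Jordan_parts[OF assms(2)] assms(1)
  by (simp add: integral_bounded_linear bounded_linear.linear linear_diff)

lemma signed_integral_cong:
  fixes f g :: "'a \<Rightarrow> 'b::{banach, second_countable_topology}"
  assumes "\<And>x. x \<in> space M \<Longrightarrow> f x = g x"
  shows "signed_integral M \<nu> f = signed_integral M \<nu> g"
  unfolding signed_integral_def using assms sm
  by (intro arg_cong2[of _ _ _ _ "(-)"] Bochner_Integration.integral_cong) simp_all

text \<open>The densities turn both parts into Bochner integrals against one finite measure, where
  measurability in the parameter is known. Integrability is not asked for: both ways of writing an
  integral agree also when it takes its default value.\<close>

lemma borel_measurable_signed_integral:
  fixes f :: "'x \<Rightarrow> 'a \<Rightarrow> 'b::{banach, second_countable_topology}"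
  assumes f: "(\<lambda>(x, y). f x y) \<in> borel_measurable (N \<Otimes>\<^sub>M M)"
  shows "(\<lambda>x. signed_integral M \<nu> (f x)) \<in> borel_measurable N"
proof -
  interpret finite_measure "tv_measure M \<nu>"
    by (rule finite_measure_tv_measure[OF sm])
  obtain p where p: "p \<in> borel_measurable M" "\<And>x. 0 \<le> p x" "\<And>x. p x \<le> (1::real)"
    "pos_part_measure M \<nu> = density (tv_measure M \<nu>) (\<lambda>x. ennreal (p x))"
    "neg_part_measure M \<nu> = density (tv_measure M \<nu>) (\<lambda>x. ennreal (1 - p x))"
    using Jordan_density[OF sm] by blast
  have sets[measurable_cong]: "sets (tv_measure M \<nu>) = sets M"
    using sm by simp
  have p'[measurable]: "p \<in> borel_measurable (tv_measure M \<nu>)"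
    using p(1) by (simp add: borel_measurable_tv_measure)
  have f'[measurable]: "(\<lambda>(x, y). f x y) \<in> borel_measurable (N \<Otimes>\<^sub>M tv_measure M \<nu>)"
    using f by (simp cong: measurable_cong_sets sets_pair_measure_cong add: sets)
  have meas: "f x \<in> borel_measurable (tv_measure M \<nu>)" if "x \<in> space N" for x
    using measurable_compose[OF measurable_Pair1'[OF that] f'] by simp
  have "(\<lambda>x. (\<integral>y. p y *\<^sub>R f x y \<partial>tv_measure M \<nu>) - (\<integral>y. (1 - p y) *\<^sub>R f x y \<partial>tv_measure M \<nu>))
      \<in> borel_measurable N"
    by measurable
  moreover have "signed_integral M \<nu> (f x) =
      (\<integral>y. p y *\<^sub>R f x y \<partial>tv_measure M \<nu>) - (\<integral>y. (1 - p y) *\<^sub>R f x y \<partial>tv_measure M \<nu>)"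
    if "x \<in> space N" for x
    unfolding signed_integral_def p(4,5) using meas[OF that] p(2,3)
    by (subst (1 2) integral_density) auto
  ultimately show ?thesis
    by (subst measurable_cong)
qed

text \<open>The weights \<open>p\<close> and \<open>1 - p\<close> add up to 1, so the bounds for the
  two parts recombine to a single integral. Bounding each part by the total variation would cost a
  factor 2, which would spoil the constant in the theorem.\<close>

lemma norm_signed_integral_le:
  fixes f :: "'a \<Rightarrow> 'b::{banach, second_countable_topology}"
  assumes f: "integrable (tv_measure M \<nu>) f"
  shows "ennreal (norm (signed_integral M \<nu> f)) \<le> (\<integral>\<^sup>+x. ennreal (norm (f x)) \<partial>tv_measure M \<nu>)"
proof -
  obtain p where p: "p \<in> borel_measurable M" "\<And>x. 0 \<le> p x" "\<And>x. p x \<le> (1::real)"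
    "pos_part_measure M \<nu> = density (tv_measure M \<nu>) (\<lambda>x. ennreal (p x))"
    "neg_part_measure M \<nu> = density (tv_measure M \<nu>) (\<lambda>x. ennreal (1 - p x))"
    using Jordan_density[OF sm] by blast
  have [measurable]: "f \<in> borel_measurable (tv_measure M \<nu>)" "p \<in> borel_measurable (tv_measure M \<nu>)"
    using borel_measurable_integrable[OF f] p(1) by (simp_all add: borel_measurable_tv_measure)
  have "ennreal (norm (signed_integral M \<nu> f))
      \<le> ennreal (norm (integral\<^sup>L (pos_part_measure M \<nu>) f)) + ennreal (norm (integral\<^sup>L (neg_part_measure M \<nu>) f))"
    unfolding signed_integral_def
    by (simp add: norm_triangle_ineq4 ennreal_leI flip: ennreal_plus)
  also have "\<dots> \<le> (\<integral>\<^sup>+x. ennreal (norm (f x)) \<partial>pos_part_measure M \<nu>)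
      + (\<integral>\<^sup>+x. ennreal (norm (f x)) \<partial>neg_part_measure M \<nu>)"
    using integrable_Jordan_parts[OF f] by (intro add_mono integral_norm_bound_ennreal)
  also have "\<dots> = (\<integral>\<^sup>+x. ennreal (p x) * ennreal (norm (f x)) + ennreal (1 - p x) * ennreal (norm (f x)) \<partial>tv_measure M \<nu>)"
    unfolding p(4,5) by (simp add: nn_integral_density nn_integral_add)
  also have "\<dots> = (\<integral>\<^sup>+x. ennreal (norm (f x)) \<partial>tv_measure M \<nu>)"
  proof (intro nn_integral_cong)
    fix x
    have "ennreal (p x) + ennreal (1 - p x) = 1"
      using p(2,3)[of x] by (subst ennreal_plus[symmetric]) auto
    then show "ennreal (p x) * ennreal (norm (f x)) + ennreal (1 - p x) * ennreal (norm (f x)) = ennreal (norm (f x))"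
      by (simp flip: distrib_right)
  qed
  finally show ?thesis .
qed

lemma Fubini_signed_integral:
  fixes g :: "'x \<Rightarrow> 'a \<Rightarrow> real"
  assumes N: "sigma_finite_measure N"
    and g: "integrable (N \<Otimes>\<^sub>M tv_measure M \<nu>) (\<lambda>(x, y). g x y)"
  shows "(\<integral>x. signed_integral M \<nu> (g x) \<partial>N) = signed_integral M \<nu> (\<lambda>y. \<integral>x. g x y \<partial>N)"
proof -
  interpret finite_measure "tv_measure M \<nu>"
    by (rule finite_measure_tv_measure[OF sm])
  interpret N: sigma_finite_measure N by fact
  interpret pair_sigma_finite N "tv_measure M \<nu>" ..
  obtain p where p: "p \<in> borel_measurable M" "\<And>x. 0 \<le> p x" "\<And>x. p x \<le> (1::real)"
    "pos_part_measure M \<nu> = density (tv_measure M \<nu>) (\<lambda>x. ennreal (p x))"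
    "neg_part_measure M \<nu> = density (tv_measure M \<nu>) (\<lambda>x. ennreal (1 - p x))"
    using Jordan_density[OF sm] by blast
  have [measurable]: "p \<in> borel_measurable (tv_measure M \<nu>)"
    using p(1) by (simp add: borel_measurable_tv_measure)
  \<comment> \<open>This is \<open>p - (1 - p)\<close>, the density of \<open>\<nu>\<close> with
    respect to its total variation. With it the signed integral becomes one Bochner integral, to
    which the usual Fubini theorem applies.\<close>
  define \<sigma> where "\<sigma> y = 2 * p y - 1" for y
  have \<sigma>[measurable]: "\<sigma> \<in> borel_measurable (tv_measure M \<nu>)"
    unfolding \<sigma>_def by measurable
  have abs_\<sigma>: "\<bar>\<sigma> y\<bar> \<le> 1" for y
    using p(2,3)[of y] by (auto simp: \<sigma>_def)
  have polar: "signed_integral M \<nu> f = (\<integral>y. \<sigma> y * f y \<partial>tv_measure M \<nu>)"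
    if "integrable (tv_measure M \<nu>) f" for f
  proof -
    have [measurable]: "f \<in> borel_measurable (tv_measure M \<nu>)"
      using that by auto
    have "integrable (tv_measure M \<nu>) (\<lambda>y. p y * f y)"
      using integrable_Jordan_parts(1)[OF that] p(2) unfolding p(4)
      by (subst (asm) integrable_density) auto
    moreover have "integrable (tv_measure M \<nu>) (\<lambda>y. (1 - p y) * f y)"
      using integrable_Jordan_parts(2)[OF that] p(3) unfolding p(5)
      by (subst (asm) integrable_density) auto
    ultimately have "signed_integral M \<nu> f = (\<integral>y. p y * f y - (1 - p y) * f y \<partial>tv_measure M \<nu>)"
      unfolding signed_integral_def p(4,5) using p(2,3)
      by (subst (1 2) integral_density) auto
    then show ?thesis
      by (simp add: \<sigma>_def algebra_simps)
  qed
  have int: "integrable (N \<Otimes>\<^sub>M tv_measure M \<nu>) (\<lambda>(x, y). \<sigma> y * g x y)"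
  proof (rule Bochner_Integration.integrable_bound[OF g])
    have "(\<lambda>z. \<sigma> (snd z) * (case z of (x, y) \<Rightarrow> g x y)) \<in> borel_measurable (N \<Otimes>\<^sub>M tv_measure M \<nu>)"
      using g by (intro borel_measurable_times) auto
    then show "(\<lambda>(x, y). \<sigma> y * g x y) \<in> borel_measurable (N \<Otimes>\<^sub>M tv_measure M \<nu>)"
      by (simp add: case_prod_beta')
    show "AE z in N \<Otimes>\<^sub>M tv_measure M \<nu>. norm (case z of (x, y) \<Rightarrow> \<sigma> y * g x y) \<le> norm (case z of (x, y) \<Rightarrow> g x y)"
    proof (intro AE_I2)
      fix z
      show "norm (case z of (x, y) \<Rightarrow> \<sigma> y * g x y) \<le> norm (case z of (x, y) \<Rightarrow> g x y)"
        using mult_right_mono[OF abs_\<sigma>[of "snd z"] abs_ge_zero[of "g (fst z) (snd z)"]]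
        by (simp add: case_prod_beta abs_mult)
    qed
  qed
  have "AE x in N. integrable (tv_measure M \<nu>) (g x)"
    using AE_integrable_fst[OF g] .
  then have "AE x in N. signed_integral M \<nu> (g x) = (\<integral>y. \<sigma> y * g x y \<partial>tv_measure M \<nu>)"
    by eventually_elim (rule polar)
  then have "(\<integral>x. signed_integral M \<nu> (g x) \<partial>N) = (\<integral>x. \<integral>y. \<sigma> y * g x y \<partial>tv_measure M \<nu> \<partial>N)"
  proof (rule integral_cong_AE[rotated 2])
    show "(\<lambda>x. signed_integral M \<nu> (g x)) \<in> borel_measurable N"
      using g sm by (intro borel_measurable_signed_integral)
        (auto dest!: borel_measurable_integrable cong: measurable_cong_sets sets_pair_measure_cong)
    show "(\<lambda>x. \<integral>y. \<sigma> y * g x y \<partial>tv_measure M \<nu>) \<in> borel_measurable N"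
      by (rule borel_measurable_integrable) (rule integrable_fst[OF int])
  qed
  also have "\<dots> = (\<integral>y. \<integral>x. \<sigma> y * g x y \<partial>N \<partial>tv_measure M \<nu>)"
    by (rule Fubini_integral[OF int, symmetric])
  also have "\<dots> = (\<integral>y. \<sigma> y * (\<integral>x. g x y \<partial>N) \<partial>tv_measure M \<nu>)"
    by simp
  also have "\<dots> = signed_integral M \<nu> (\<lambda>y. \<integral>x. g x y \<partial>N)"
    by (rule polar[symmetric]) (rule integrable_snd[OF g])
  finally show ?thesis .
qed

end

section \<open>Adjoints in Hilbert space\<close>

text \<open>The representing vector minimizes \<open>\<parallel>x\<parallel>\<^sup>2 - 2 f x\<close>; by the parallelogram law every
  minimizing sequence is Cauchy.\<close>

theorem Riesz_representation:
  fixes f :: "'a::{real_inner, banach} \<Rightarrow> real"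
  assumes "bounded_linear f"
  shows "\<exists>y. \<forall>x. f x = x \<bullet> y"
proof -
  interpret f: bounded_linear f by fact
  define J where "J x = (norm x)\<^sup>2 - 2 * f x" for x
  obtain B where B: "\<And>x. norm (f x) \<le> norm x * B"
    using f.bounded by blast
  have "- B\<^sup>2 \<le> J x" for x
  proof -
    have "f x \<le> norm x * B"
      using B[of x] by simp
    moreover have "0 \<le> (norm x - B)\<^sup>2"
      by simp
    ultimately show ?thesis
      by (simp add: J_def power2_diff algebra_simps)
  qed
  then have bdd: "bdd_below (range J)"
    by (auto intro!: bdd_belowI)
  define m where "m = Inf (range J)"
  have m_le: "m \<le> J x" for x
    unfolding m_def using bdd by (intro cInf_lower) auto
  have "\<exists>x. J x < m + 1 / Suc n" for n
    using cInf_lessD[of "range J" "m + 1 / Suc n"] by (auto simp: m_def)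
  then obtain X where X: "\<And>n. J (X n) < m + 1 / Suc n"
    by metis
  have par: "(norm (x - y))\<^sup>2 \<le> 2 * (J x + J y - 2 * m)" for x y
  proof -
    have "(norm (x - y))\<^sup>2 = 2 * (J x + J y - 2 * J ((1/2) *\<^sub>R (x + y)))"
      by (simp add: J_def f.add f.scaleR power2_norm_eq_inner inner_simps inner_commute field_simps)
    then show ?thesis
      using m_le[of "(1/2) *\<^sub>R (x + y)"] by simp
  qed
  have "Cauchy X"
  proof (rule metric_CauchyI)
    fix e :: real assume "e > 0"
    \<comment> \<open>From \<open>N\<close> on, both values of \<open>J\<close> exceed
      \<open>m\<close> by less than \<open>e\<^sup>2 / 4\<close>, and \<open>par\<close> doubles the
      sum of the two excesses.\<close>
    obtain N where N: "inverse (real (Suc N)) < e\<^sup>2 / 4"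
      using reals_Archimedean[of "e\<^sup>2 / 4"] \<open>e > 0\<close> by auto
    have "dist (X i) (X j) < e" if "i \<ge> N" "j \<ge> N" for i j
    proof -
      have *: "1 / Suc i \<le> inverse (real (Suc N))" "1 / Suc j \<le> inverse (real (Suc N))"
        using that by (auto simp: field_simps)
      have "(norm (X i - X j))\<^sup>2 \<le> 2 * (J (X i) + J (X j) - 2 * m)"
        by (rule par)
      also have "\<dots> < e\<^sup>2"
        using X[of i] X[of j] N * by argo
      finally show ?thesis
        using \<open>e > 0\<close> by (simp add: dist_norm power2_less_imp_less)
    qed
    then show "\<exists>N. \<forall>i\<ge>N. \<forall>j\<ge>N. dist (X i) (X j) < e"
      by blast
  qed
  then obtain y where y: "X \<longlonglongrightarrow> y"
    using Cauchy_convergent convergent_def by blast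
  have "(\<lambda>n. J (X n)) \<longlonglongrightarrow> J y"
    unfolding J_def by (intro tendsto_intros f.tendsto y)
  moreover have "(\<lambda>n. m + 1 / Suc n) \<longlonglongrightarrow> m + 0"
    by (intro tendsto_intros LIMSEQ_Suc[OF lim_1_over_n])
  ultimately have "J y \<le> m + 0"
    using X by (intro LIMSEQ_le) (auto intro: less_imp_le)
  then have min: "J y \<le> J x" for x
    using m_le[of x] by simp
  have "f h = h \<bullet> y" for h
  proof -
    define c where "c = h \<bullet> y - f h"
    \<comment> \<open>\<open>- c / d\<close> approximates the minimizer of the quadratic in
      \<open>expand\<close>; the added 1 avoids a division by zero for \<open>h = 0\<close> and
      still yields a negative value unless \<open>c = 0\<close>.\<close>
    define d where "d = (norm h)\<^sup>2 + 1"
    have "d > 0"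
      by (simp add: d_def add_nonneg_pos)
    have expand: "J (y + t *\<^sub>R h) - J y = t\<^sup>2 * (norm h)\<^sup>2 + 2 * t * c" for t
      unfolding J_def c_def f.add f.scaleR power2_norm_eq_inner
      by (simp add: inner_simps inner_commute algebra_simps power2_eq_square)
    have "0 \<le> J (y + (- c / d) *\<^sub>R h) - J y"
      using min by simp
    also have "\<dots> = (c / d)\<^sup>2 * (norm h)\<^sup>2 - 2 * (c / d) * c"
      unfolding expand by (simp add: power2_eq_square)
    also have "\<dots> = - (c\<^sup>2 * (d + 1) / d\<^sup>2)"
    proof -
      have norm_h: "(norm h)\<^sup>2 = d - 1"
        by (simp add: d_def)
      show ?thesis
        unfolding norm_h using \<open>d > 0\<close> by (simp add: field_simps power2_eq_square)
    qed
    finally have "c\<^sup>2 * (d + 1) / d\<^sup>2 \<le> 0"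
      by simp
    then have "c = 0"
      using \<open>d > 0\<close> by (auto simp: divide_le_0_iff mult_le_0_iff)
    then show ?thesis by (simp add: c_def)
  qed
  then show ?thesis by blast
qed

context
  fixes A :: "'a::{real_inner, banach} \<Rightarrow> 'b::real_inner"
  assumes A: "bounded_linear A"
begin

text \<open>\<open>adjoint\<close> chooses some map satisfying the adjoint equation. Representing
  the functional \<open>\<lambda>x. A x \<bullet> y\<close> for every \<open>y\<close> shows that
  there is one.\<close>

lemma inner_adjoint_Hilbert: "x \<bullet> adjoint A y = A x \<bullet> y"
proof -
  have "\<exists>g. \<forall>x. A x \<bullet> y = x \<bullet> g" for y
    by (rule Riesz_representation) (intro bounded_linear_inner_left_comp A)
  then have "\<exists>g. \<forall>x y. A x \<bullet> y = x \<bullet> g y"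
    by metis
  then have "\<forall>x y. A x \<bullet> y = x \<bullet> adjoint A y"
    unfolding adjoint_def by (rule someI_ex)
  then show ?thesis by simp
qed

text \<open>Put \<open>x = adjoint A y\<close> in the adjoint equation, apply Cauchy-Schwarz and
  divide by the norm of \<open>x\<close>.\<close>

lemma norm_adjoint_le: "norm (adjoint A y) \<le> onorm A * norm y"
proof (cases "adjoint A y = 0")
  case False
  have "norm (adjoint A y) * norm (adjoint A y) = A (adjoint A y) \<bullet> y"
    by (simp add: inner_adjoint_Hilbert[symmetric] flip: power2_eq_square power2_norm_eq_inner)
  also have "\<dots> \<le> norm (A (adjoint A y)) * norm y"
    by (rule norm_cauchy_schwarz)
  also have "\<dots> \<le> (onorm A * norm (adjoint A y)) * norm y"
    by (intro mult_right_mono onorm A) simp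
  finally have "norm (adjoint A y) * norm (adjoint A y) \<le> (onorm A * norm y) * norm (adjoint A y)"
    by (simp add: ac_simps)
  then show ?thesis
    using False by (simp add: mult_le_cancel_right)
qed (simp add: onorm_pos_le[OF A])

lemma bounded_linear_adjoint: "bounded_linear (adjoint A)"
proof (rule bounded_linear_intro)
  show "adjoint A (x + y) = adjoint A x + adjoint A y" for x y
    by (rule vector_eq_rdot[THEN iffD1])
       (simp add: inner_simps inner_adjoint_Hilbert inner_commute[of "adjoint A _"])
  show "adjoint A (r *\<^sub>R x) = r *\<^sub>R adjoint A x" for r x
    by (rule vector_eq_rdot[THEN iffD1])
       (simp add: inner_simps inner_adjoint_Hilbert inner_commute[of "adjoint A _"])
  show "norm (adjoint A x) \<le> norm x * onorm A" for x
    using norm_adjoint_le by (simp add: mult.commute)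
qed

end

definition adjoint_blinfun ::
    "('a::{real_inner, banach} \<Rightarrow>\<^sub>L 'b::real_inner) \<Rightarrow> 'b \<Rightarrow>\<^sub>L 'a" where
  "adjoint_blinfun A = Blinfun (adjoint (blinfun_apply A))"

lemma adjoint_blinfun_apply: "blinfun_apply (adjoint_blinfun A) = adjoint (blinfun_apply A)"
  unfolding adjoint_blinfun_def
  by (rule bounded_linear_Blinfun_apply) (intro bounded_linear_adjoint blinfun.bounded_linear_right)

lemma inner_adjoint_blinfun: "x \<bullet> blinfun_apply (adjoint_blinfun A) y = blinfun_apply A x \<bullet> y"
  by (simp add: adjoint_blinfun_apply inner_adjoint_Hilbert blinfun.bounded_linear_right)

lemma norm_adjoint_blinfun_le: "norm (adjoint_blinfun A) \<le> norm A"
  unfolding norm_blinfun.rep_eq[of A] adjoint_blinfun_apply[symmetric]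
  by (rule norm_blinfun_bound)
     (simp_all add: adjoint_blinfun_apply norm_adjoint_le onorm_pos_le blinfun.bounded_linear_right)

section \<open>Measurability of operator-valued functions\<close>

text \<open>A violation of the inequality is an open condition, so it would already occur at a point
  of \<open>D\<close>.\<close>

lemma le_on_dense:
  fixes f g :: "'a::topological_space \<Rightarrow> real"
  assumes D: "\<And>X. open X \<Longrightarrow> X \<noteq> {} \<Longrightarrow> \<exists>d\<in>D. d \<in> X"
    and "continuous_on UNIV f" "continuous_on UNIV g" "\<And>d. d \<in> D \<Longrightarrow> f d \<le> g d"
  shows "f x \<le> g x"
proof (rule ccontr)
  assume "\<not> ?thesis"
  moreover have "open {x. g x < f x}"
    using assms(2,3) by (rule open_Collect_less[rotated])
  ultimately obtain d where "d \<in> D" "g d < f d"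
    using D[of "{x. g x < f x}"] by (auto simp: not_le)
  then show False using assms(4)[of d] by simp
qed

text \<open>By density, a bound on the norm amounts to countably many bounds on inner products,
  which makes the sublevel sets of the norm countable intersections.\<close>

lemma borel_measurable_norm_weak:
  fixes g :: "'x \<Rightarrow> 'a::{real_inner, second_countable_topology}"
  assumes [measurable]: "\<And>e. (\<lambda>x. g x \<bullet> e) \<in> borel_measurable M"
  shows "(\<lambda>x. norm (g x)) \<in> borel_measurable M"
proof (rule borel_measurableI_le)
  obtain D :: "'a set" where "countable D" and D: "\<And>X. open X \<Longrightarrow> X \<noteq> {} \<Longrightarrow> \<exists>d\<in>D. d \<in> X"
    by (erule countable_dense_setE)
  fix a :: real
  have "norm v \<le> a \<longleftrightarrow> 0 \<le> a \<and> (\<forall>d\<in>D. v \<bullet> d \<le> a * norm d)" for v :: 'a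
  proof safe
    assume "norm v \<le> a"
    then show "0 \<le> a"
      by (rule order_trans[OF norm_ge_zero])
    show "v \<bullet> d \<le> a * norm d" for d
      by (rule order_trans[OF norm_cauchy_schwarz]) (intro mult_right_mono \<open>norm v \<le> a\<close> norm_ge_zero)
  next
    assume "0 \<le> a" and *: "\<forall>d\<in>D. v \<bullet> d \<le> a * norm d"
    have "v \<bullet> v \<le> a * norm v"
      by (rule le_on_dense[OF D]) (use * in \<open>auto intro!: continuous_intros\<close>)
    then have "norm v * norm v \<le> a * norm v"
      by (simp flip: power2_norm_eq_inner add: power2_eq_square)
    then show "norm v \<le> a"
      using \<open>0 \<le> a\<close> by (cases "v = 0") (auto simp: mult_le_cancel_right)
  qed
  then have "{x \<in> space M. norm (g x) \<le> a} =
      {x \<in> space M. 0 \<le> a \<and> (\<forall>d\<in>D. g x \<bullet> d \<le> a * norm d)}"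
    by simp
  also have "\<dots> \<in> sets M"
    using \<open>countable D\<close> by measurable
  finally show "{x \<in> space M. norm (g x) \<le> a} \<in> sets M" .
qed

text \<open>The operator norm is determined by the values on a countable dense set. This makes the
  integrals in \<open>lag_M0\<close> and \<open>lag_M\<close> accessible to Tonelli although the
  kernel is only strongly measurable.\<close>

lemma borel_measurable_norm_blinfun:
  fixes A :: "'x \<Rightarrow> 'a::{real_normed_vector, second_countable_topology} \<Rightarrow>\<^sub>L 'b::real_normed_vector"
  assumes [measurable]: "\<And>e. (\<lambda>x. blinfun_apply (A x) e) \<in> borel_measurable M"
  shows "(\<lambda>x. norm (A x)) \<in> borel_measurable M"
proof (rule borel_measurableI_le)
  obtain D :: "'a set" where "countable D" and D: "\<And>X. open X \<Longrightarrow> X \<noteq> {} \<Longrightarrow> \<exists>d\<in>D. d \<in> X"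
    by (erule countable_dense_setE)
  fix a :: real
  have "norm B \<le> a \<longleftrightarrow> 0 \<le> a \<and> (\<forall>d\<in>D. norm (blinfun_apply B d) \<le> a * norm d)" for B :: "'a \<Rightarrow>\<^sub>L 'b"
  proof safe
    assume "norm B \<le> a"
    then show "0 \<le> a"
      by (rule order_trans[OF norm_ge_zero])
    show "norm (blinfun_apply B d) \<le> a * norm d" for d
      by (rule order_trans[OF norm_blinfun]) (intro mult_right_mono \<open>norm B \<le> a\<close> norm_ge_zero)
  next
    assume "0 \<le> a" and *: "\<forall>d\<in>D. norm (blinfun_apply B d) \<le> a * norm d"
    have "norm (blinfun_apply B e) \<le> a * norm e" for e
      by (rule le_on_dense[OF D]) (use * in \<open>auto intro!: continuous_intros\<close>)
    then show "norm B \<le> a"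
      using \<open>0 \<le> a\<close> by (intro norm_blinfun_bound)
  qed
  then have "{x \<in> space M. norm (A x) \<le> a} =
      {x \<in> space M. 0 \<le> a \<and> (\<forall>d\<in>D. norm (blinfun_apply (A x) d) \<le> a * norm d)}"
    by simp
  also have "\<dots> \<in> sets M"
    using \<open>countable D\<close> by measurable
  finally show "{x \<in> space M. norm (A x) \<le> a} \<in> sets M" .
qed

text \<open>In a separable space balls form a countable base, and the preimage of a ball around
  \<open>d\<close> is a sublevel set of \<open>norm (g x - d)\<close>, for which weak measurability
  is enough.\<close>

lemma Pettis_measurability:
  fixes g :: "'x \<Rightarrow> 'a::{real_inner, second_countable_topology}"
  assumes [measurable]: "\<And>e. (\<lambda>x. g x \<bullet> e) \<in> borel_measurable M"
  shows "g \<in> borel_measurable M"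
proof -
  obtain D :: "'a set" where D: "topological_basis (case_prod ball ` (D \<times> (\<rat> \<inter> {0<..})))" "countable D"
    by (rule balls_countable_basis)
  let ?B = "case_prod ball ` (D \<times> (\<rat> \<inter> {0<..}))"
  have "countable ?B"
    using D(2) countable_rat by blast
  then have "borel = sigma UNIV ?B"
    using D(1) by (rule borel_eq_countable_basis)
  moreover have "g \<in> measurable M (sigma UNIV ?B)"
  proof (rule measurable_measure_of)
    show "g -` U \<inter> space M \<in> sets M" if "U \<in> ?B" for U
    proof -
      obtain d r where U: "U = ball d r"
        using \<open>U \<in> ?B\<close> by (auto split: prod.splits)
      have [measurable]: "(\<lambda>x. norm (g x - d)) \<in> borel_measurable M"
        by (rule borel_measurable_norm_weak) (simp add: inner_diff_left)
      have "g -` U \<inter> space M = {x \<in> space M. norm (g x - d) < r}"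
        by (auto simp: U dist_norm norm_minus_commute)
      then show ?thesis by simp
    qed
  qed auto
  ultimately show ?thesis by simp
qed

text \<open>The inner product of the adjoint value with \<open>e\<close> is that of
  \<open>A x e\<close> with \<open>f\<close>. Hence the adjoint is weakly measurable, which suffices
  by Pettis.\<close>

lemma borel_measurable_adjoint_blinfun:
  fixes A :: "'x \<Rightarrow> 'a::{real_inner, banach, second_countable_topology} \<Rightarrow>\<^sub>L
                'b::{real_inner, second_countable_topology}"
  assumes [measurable]: "\<And>e. (\<lambda>x. blinfun_apply (A x) e) \<in> borel_measurable M"
  shows "(\<lambda>x. blinfun_apply (adjoint_blinfun (A x)) f) \<in> borel_measurable M"
  by (rule Pettis_measurability) (subst inner_commute, simp add: inner_adjoint_blinfun)

text \<open>A simple function in place of \<open>g\<close> involves only finitely many vectors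
  \<open>e\<close>; the general case is a pointwise limit, since every \<open>A x\<close> is
  continuous.\<close>

lemma borel_measurable_blinfun_apply:
  fixes A :: "'x \<Rightarrow> 'a::{real_normed_vector, second_countable_topology} \<Rightarrow>\<^sub>L 'b::real_normed_vector"
  assumes A: "\<And>e. (\<lambda>x. blinfun_apply (A x) e) \<in> borel_measurable M"
    and g: "g \<in> borel_measurable M"
  shows "(\<lambda>x. blinfun_apply (A x) (g x)) \<in> borel_measurable M"
proof -
  obtain s where s: "\<And>i. simple_function M (s i)"
      and lim: "\<And>x. x \<in> space M \<Longrightarrow> (\<lambda>i. s i x) \<longlonglongrightarrow> g x"
    using borel_measurable_implies_sequence_metric[OF g] by blast
  have "(\<lambda>x. blinfun_apply (A x) (s i x)) \<in> borel_measurable M" for i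
  proof (rule measurable_compose_countable'[where f = "\<lambda>e x. blinfun_apply (A x) e" and I = "s i ` space M"])
    show fin: "countable (s i ` space M)"
      using simple_functionD(1)[OF s] by (rule countable_finite)
    show "s i \<in> measurable M (count_space (s i ` space M))"
      using fin simple_functionD(2)[OF s] by (subst measurable_count_space_eq_countable) auto
  qed (rule A)
  then show ?thesis
    by (rule borel_measurable_LIMSEQ_metric[where f = "\<lambda>i x. blinfun_apply (A x) (s i x)"])
       (intro blinfun.tendsto tendsto_const lim)
qed

section \<open>Square integrable functions\<close>

lemma L2_space_measurable: "f \<in> L2_space M \<Longrightarrow> f \<in> borel_measurable M"
  by (simp add: L2_space_def)

lemma L2_space_iff:
  "f \<in> L2_space M \<longleftrightarrow> f \<in> borel_measurable M \<and> (\<integral>\<^sup>+x. ennreal ((norm (f x))\<^sup>2) \<partial>M) < \<infinity>"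
  by (auto simp: L2_space_def integrable_iff_bounded)

lemma L2_norm_nonneg: "0 \<le> L2_norm M f"
  by (simp add: L2_norm_def)

lemma ennreal_L2_norm_power2:
  assumes "f \<in> L2_space M"
  shows "ennreal ((L2_norm M f)\<^sup>2) = (\<integral>\<^sup>+x. ennreal ((norm (f x))\<^sup>2) \<partial>M)"
  using assms by (simp add: L2_norm_def L2_space_def nn_integral_eq_integral)

lemma L2_space_add:
  fixes f g :: "'a \<Rightarrow> 'b::{real_inner, second_countable_topology}"
  assumes "f \<in> L2_space M" "g \<in> L2_space M"
  shows "(\<lambda>x. f x + g x) \<in> L2_space M"
proof -
  have [measurable]: "f \<in> borel_measurable M" "g \<in> borel_measurable M"
    using assms by (auto simp: L2_space_def)
  have "(norm (u + v))\<^sup>2 \<le> 2 * ((norm u)\<^sup>2 + (norm v)\<^sup>2)" for u v :: 'b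
  proof -
    have "(norm (u + v))\<^sup>2 + (norm (u - v))\<^sup>2 = 2 * ((norm u)\<^sup>2 + (norm v)\<^sup>2)"
      by (simp add: power2_norm_eq_inner inner_simps)
    then show ?thesis
      using zero_le_power2[of "norm (u - v)"] by linarith
  qed
  then have le: "AE x in M. norm ((norm (f x + g x))\<^sup>2) \<le> norm (2 * ((norm (f x))\<^sup>2 + (norm (g x))\<^sup>2))"
    by simp
  have "integrable M (\<lambda>x. 2 * ((norm (f x))\<^sup>2 + (norm (g x))\<^sup>2))"
    using assms by (simp add: L2_space_def)
  then have "integrable M (\<lambda>x. (norm (f x + g x))\<^sup>2)"
    by (rule Bochner_Integration.integrable_bound[OF _ _ le]) measurable
  then show ?thesis by (simp add: L2_space_def)
qed

lemma L2_space_scaleR: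
  fixes f :: "'a \<Rightarrow> 'b::{real_inner, second_countable_topology}"
  assumes "f \<in> L2_space M"
  shows "(\<lambda>x. c *\<^sub>R f x) \<in> L2_space M"
  using assms by (auto simp: L2_space_def power_mult_distrib)

lemma L2_space_diff:
  fixes f g :: "'a \<Rightarrow> 'b::{real_inner, second_countable_topology}"
  assumes "f \<in> L2_space M" "g \<in> L2_space M"
  shows "(\<lambda>x. f x - g x) \<in> L2_space M"
  using L2_space_add[OF assms(1) L2_space_scaleR[OF assms(2), of "-1"]] by simp

lemma integrable_L2_inner:
  fixes f g :: "'a \<Rightarrow> 'b::{real_inner, second_countable_topology}"
  assumes "f \<in> L2_space M" "g \<in> L2_space M"
  shows "integrable M (\<lambda>x. f x \<bullet> g x)"
proof (rule Bochner_Integration.integrable_bound)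
  show "integrable M (\<lambda>x. (norm (f x))\<^sup>2 + (norm (g x))\<^sup>2)"
    using assms by (auto simp: L2_space_def)
  show "(\<lambda>x. f x \<bullet> g x) \<in> borel_measurable M"
    using assms by (intro borel_measurable_inner) (auto simp: L2_space_def)
  have "\<bar>u \<bullet> v\<bar> \<le> (norm u)\<^sup>2 + (norm v)\<^sup>2" for u v :: 'b
    using Cauchy_Schwarz_ineq2[of u v] sum_squares_bound[of "norm u" "norm v"]
      mult_nonneg_nonneg[OF norm_ge_zero[of u] norm_ge_zero[of v]] by linarith
  then show "AE x in M. norm (f x \<bullet> g x) \<le> norm ((norm (f x))\<^sup>2 + (norm (g x))\<^sup>2)"
    by auto
qed

lemma L2_norm_zero_AE:
  assumes "f \<in> L2_space M" "L2_norm M f = 0"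
  shows "AE x in M. f x = 0"
proof -
  have "(LINT x|M. (norm (f x))\<^sup>2) = 0"
    using assms(2) by (simp add: L2_norm_def)
  then show ?thesis
    using assms(1) by (subst (asm) integral_nonneg_eq_0_iff_AE) (auto simp: L2_space_def)
qed

text \<open>Testing with \<open>h = f - g\<close> makes the norm of the difference vanish.\<close>

lemma L2_eqI_inner:
  fixes f g :: "'a \<Rightarrow> 'b::{real_inner, second_countable_topology}"
  assumes f: "f \<in> L2_space M" and g: "g \<in> L2_space M"
    and eq: "\<And>h. h \<in> L2_space M \<Longrightarrow> L2_inner M h f = L2_inner M h g"
  shows "AE x in M. f x = g x"
proof -
  let ?h = "\<lambda>x. f x - g x"
  have h: "?h \<in> L2_space M"
    using f g by (rule L2_space_diff)
  have "(LINT x|M. ?h x \<bullet> f x - ?h x \<bullet> g x) = 0"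
    using eq[OF h] integrable_L2_inner[OF h f] integrable_L2_inner[OF h g]
    by (simp add: L2_inner_def)
  then have "L2_norm M ?h = 0"
    by (simp add: L2_norm_def power2_norm_eq_inner flip: inner_diff_right)
  then show ?thesis
    using L2_norm_zero_AE[OF h] by simp
qed

section \<open>Integral operators along shifts\<close>

text \<open>The operator \<open>R\<close> of the theorem and the candidate for its adjoint are both of the form
  \<open>f \<mapsto> \<integral> H(t,\<theta>) f(t + s(\<theta>)) \<nu>(d\<theta>)\<close>, with \<open>s(\<theta>) = -\<theta>\<close> and \<open>s(\<theta>) = \<theta>\<close>, respectively, and with the
  roles of the two kernel bounds exchanged.\<close>

locale shift_kernel =
  fixes M :: "'a measure" and \<nu> :: "'a set \<Rightarrow> real" and s :: "'a \<Rightarrow> real"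
    and H :: "real \<Rightarrow> 'a \<Rightarrow> 'e::{real_inner, banach, second_countable_topology}
                \<Rightarrow>\<^sub>L 'f::{real_inner, banach, second_countable_topology}"
    and A B :: real
  assumes sm: "signed_measure M \<nu>"
    and s_measurable: "s \<in> borel_measurable M"
    and H_measurable: "\<And>e. (\<lambda>(t, \<theta>). blinfun_apply (H t \<theta>) e) \<in> borel_measurable (borel \<Otimes>\<^sub>M M)"
    and A_nonneg: "0 \<le> A" and B_nonneg: "0 \<le> B"
    and row: "\<And>t. (\<integral>\<^sup>+\<theta>. ennreal (norm (H t \<theta>)) \<partial>tv_measure M \<nu>) \<le> ennreal A"
    and column: "\<And>u. (\<integral>\<^sup>+\<theta>. ennreal (norm (H (u - s \<theta>) \<theta>)) \<partial>tv_measure M \<nu>) \<le> ennreal B"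
begin

abbreviation "\<mu> \<equiv> tv_measure M \<nu>"

text \<open>The value has no meaning at points \<open>t\<close> where the integrand is not
  integrable. For square integrable \<open>f\<close> these form a null set by
  \<open>AE_integrand_integrable\<close>, so the laws for \<open>op\<close> hold almost
  everywhere.\<close>

definition op :: "(real \<Rightarrow> 'e) \<Rightarrow> real \<Rightarrow> 'f" where
  "op f t = signed_integral M \<nu> (\<lambda>\<theta>. blinfun_apply (H t \<theta>) (f (t + s \<theta>)))"

sublocale \<mu>: finite_measure \<mu>
  by (rule finite_measure_tv_measure[OF sm])

sublocale lborel_\<mu>: pair_sigma_finite lborel \<mu>
  by unfold_locales

lemma sets_\<mu> [measurable_cong]: "sets \<mu> = sets M"
  by (rule sets_tv_measure[OF sm])

lemma sets_pair: "sets (borel \<Otimes>\<^sub>M M) = sets (lborel \<Otimes>\<^sub>M \<mu>)"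
  by (intro sets_pair_measure_cong) (simp_all add: sets_\<mu>)

lemma s_measurable_\<mu> [measurable]: "s \<in> borel_measurable \<mu>"
  using s_measurable by (simp cong: measurable_cong_sets add: sets_\<mu>)

lemma shift_measurable [measurable]:
  "f \<in> borel_measurable borel \<Longrightarrow> (\<lambda>z. f (fst z + s (snd z))) \<in> borel_measurable (lborel \<Otimes>\<^sub>M \<mu>)"
proof -
  assume "f \<in> borel_measurable borel"
  moreover have "(\<lambda>z. fst z + s (snd z)) \<in> borel_measurable (lborel \<Otimes>\<^sub>M \<mu>)"
    by measurable
  ultimately show ?thesis
    by (rule measurable_compose[rotated])
qed

lemma H_measurable_pair: "(\<lambda>z. blinfun_apply (H (fst z) (snd z)) e) \<in> borel_measurable (lborel \<Otimes>\<^sub>M \<mu>)"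
  using H_measurable[of e] by (simp add: case_prod_beta' cong: measurable_cong_sets add: sets_pair)

lemma H_shift_measurable_pair:
  "(\<lambda>z. blinfun_apply (H (fst z - s (snd z)) (snd z)) e) \<in> borel_measurable (lborel \<Otimes>\<^sub>M \<mu>)"
proof -
  have "(\<lambda>z. (fst z - s (snd z), snd z)) \<in> measurable (lborel \<Otimes>\<^sub>M \<mu>) (lborel \<Otimes>\<^sub>M \<mu>)"
    by measurable
  from measurable_compose[OF this H_measurable_pair[of e]] show ?thesis by simp
qed

lemma norm_H_measurable [measurable]:
  "(\<lambda>z. norm (H (fst z) (snd z))) \<in> borel_measurable (lborel \<Otimes>\<^sub>M \<mu>)"
  "(\<lambda>z. norm (H (fst z - s (snd z)) (snd z))) \<in> borel_measurable (lborel \<Otimes>\<^sub>M \<mu>)"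
  by (intro borel_measurable_norm_blinfun H_measurable_pair H_shift_measurable_pair)+

lemma integrand_measurable:
  assumes "f \<in> borel_measurable borel"
  shows "(\<lambda>z. blinfun_apply (H (fst z) (snd z)) (f (fst z + s (snd z)))) \<in> borel_measurable (lborel \<Otimes>\<^sub>M \<mu>)"
  by (rule borel_measurable_blinfun_apply[OF H_measurable_pair shift_measurable[OF assms]])

lemma section_measurable:
  "g \<in> borel_measurable (lborel \<Otimes>\<^sub>M \<mu>) \<Longrightarrow> (\<lambda>\<theta>. g (t, \<theta>)) \<in> borel_measurable \<mu>"
  using measurable_compose[OF measurable_Pair1'[of t lborel]] by simp

lemma op_measurable:
  assumes "f \<in> borel_measurable borel"
  shows "op f \<in> borel_measurable borel"
proof -
  have "(\<lambda>(t, \<theta>). blinfun_apply (H t \<theta>) (f (t + s \<theta>))) \<in> borel_measurable (borel \<Otimes>\<^sub>M M)"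
    using integrand_measurable[OF assms]
    by (simp add: case_prod_beta' cong: measurable_cong_sets add: sets_pair)
  then show ?thesis
    unfolding op_def by (rule borel_measurable_signed_integral[OF sm])
qed

section \<open>The Schur test\<close>

lemma nn_integral_translate:
  fixes g :: "real \<Rightarrow> ennreal"
  assumes "g \<in> borel_measurable borel"
  shows "(\<integral>\<^sup>+t. g (t + c) \<partial>lborel) = (\<integral>\<^sup>+t. g t \<partial>lborel)"
  using nn_integral_real_affine[OF assms, of 1 c] by (simp add: add.commute)

text \<open>The substitution \<open>u = t + s \<theta>\<close> is made for each fixed
  \<open>\<theta>\<close>, hence the two exchanges of the order of integration. Afterwards
  \<open>f u\<close> is free of \<open>\<theta>\<close> and factors out, and what remains is a
  column.\<close>

lemma Schur_bound:
  fixes f :: "real \<Rightarrow> 'e"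
  assumes [measurable]: "f \<in> borel_measurable borel"
  shows "(\<integral>\<^sup>+t. \<integral>\<^sup>+\<theta>. ennreal (norm (H t \<theta>) * (norm (f (t + s \<theta>)))\<^sup>2) \<partial>\<mu> \<partial>lborel)
    \<le> ennreal B * (\<integral>\<^sup>+u. ennreal ((norm (f u))\<^sup>2) \<partial>lborel)"
proof -
  let ?G = "\<lambda>z. ennreal (norm (H (fst z) (snd z)) * (norm (f (fst z + s (snd z))))\<^sup>2)"
  let ?G' = "\<lambda>z. ennreal (norm (H (fst z - s (snd z)) (snd z)) * (norm (f (fst z)))\<^sup>2)"
  have G: "?G \<in> borel_measurable (lborel \<Otimes>\<^sub>M \<mu>)" and G': "?G' \<in> borel_measurable (lborel \<Otimes>\<^sub>M \<mu>)"
    by measurable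
  have "(\<integral>\<^sup>+t. \<integral>\<^sup>+\<theta>. ?G (t, \<theta>) \<partial>\<mu> \<partial>lborel) = (\<integral>\<^sup>+\<theta>. \<integral>\<^sup>+t. ?G (t, \<theta>) \<partial>lborel \<partial>\<mu>)"
    by (rule lborel_\<mu>.Fubini'[symmetric]) (use G in simp)
  also have "\<dots> = (\<integral>\<^sup>+\<theta>. \<integral>\<^sup>+u. ?G' (u, \<theta>) \<partial>lborel \<partial>\<mu>)"
  proof (rule nn_integral_cong)
    fix \<theta> assume \<theta>: "\<theta> \<in> space \<mu>"
    have "(\<lambda>u. ?G' (u, \<theta>)) \<in> borel_measurable borel"
      using measurable_compose[OF measurable_Pair2'[OF \<theta>, of lborel] G'] by simp
    from nn_integral_translate[OF this, of "s \<theta>"]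
    show "(\<integral>\<^sup>+t. ?G (t, \<theta>) \<partial>lborel) = (\<integral>\<^sup>+u. ?G' (u, \<theta>) \<partial>lborel)"
      by simp
  qed
  also have "\<dots> = (\<integral>\<^sup>+u. \<integral>\<^sup>+\<theta>. ?G' (u, \<theta>) \<partial>\<mu> \<partial>lborel)"
    by (rule lborel_\<mu>.Fubini') (use G' in simp)
  also have "\<dots> = (\<integral>\<^sup>+u. (\<integral>\<^sup>+\<theta>. ennreal (norm (H (u - s \<theta>) \<theta>)) \<partial>\<mu>) * ennreal ((norm (f u))\<^sup>2) \<partial>lborel)"
    using section_measurable[OF norm_H_measurable(2)]
    by (simp add: ennreal_mult nn_integral_multc)
  also have "\<dots> \<le> (\<integral>\<^sup>+u. ennreal B * ennreal ((norm (f u))\<^sup>2) \<partial>lborel)"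
    by (intro nn_integral_mono mult_right_mono column) simp
  also have "\<dots> = ennreal B * (\<integral>\<^sup>+u. ennreal ((norm (f u))\<^sup>2) \<partial>lborel)"
    by (simp add: nn_integral_cmult)
  finally show ?thesis by simp
qed

text \<open>The kernel norm is split into two square roots. The square of the first factor
  integrates to a row, bounded by \<open>A\<close>; the second keeps one full power of the kernel
  norm, as \<open>Schur_bound\<close> expects.\<close>

lemma nn_integral_norm_power2_le:
  fixes f :: "real \<Rightarrow> 'e"
  assumes [measurable]: "f \<in> borel_measurable borel"
  shows "(\<integral>\<^sup>+\<theta>. ennreal (norm (blinfun_apply (H t \<theta>) (f (t + s \<theta>)))) \<partial>\<mu>)\<^sup>2
    \<le> ennreal A * (\<integral>\<^sup>+\<theta>. ennreal (norm (H t \<theta>) * (norm (f (t + s \<theta>)))\<^sup>2) \<partial>\<mu>)"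
proof -
  have [measurable]: "(\<lambda>\<theta>. norm (H t \<theta>)) \<in> borel_measurable \<mu>"
    using section_measurable[OF norm_H_measurable(1)] by simp
  have "(\<integral>\<^sup>+\<theta>. ennreal (norm (blinfun_apply (H t \<theta>) (f (t + s \<theta>)))) \<partial>\<mu>)
      \<le> (\<integral>\<^sup>+\<theta>. ennreal (sqrt (norm (H t \<theta>))) * ennreal (sqrt (norm (H t \<theta>)) * norm (f (t + s \<theta>))) \<partial>\<mu>)"
    using norm_blinfun
    by (intro nn_integral_mono) (simp add: ennreal_leI flip: ennreal_mult mult.assoc)
  then have "(\<integral>\<^sup>+\<theta>. ennreal (norm (blinfun_apply (H t \<theta>) (f (t + s \<theta>)))) \<partial>\<mu>)\<^sup>2
      \<le> (\<integral>\<^sup>+\<theta>. ennreal (sqrt (norm (H t \<theta>))) * ennreal (sqrt (norm (H t \<theta>)) * norm (f (t + s \<theta>))) \<partial>\<mu>)\<^sup>2"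
    by (rule power_mono) simp
  also have "\<dots> \<le> (\<integral>\<^sup>+\<theta>. (ennreal (sqrt (norm (H t \<theta>))))\<^sup>2 \<partial>\<mu>)
      * (\<integral>\<^sup>+\<theta>. (ennreal (sqrt (norm (H t \<theta>)) * norm (f (t + s \<theta>))))\<^sup>2 \<partial>\<mu>)"
    by (rule Cauchy_Schwarz_nn_integral) measurable
  also have "\<dots> = (\<integral>\<^sup>+\<theta>. ennreal (norm (H t \<theta>)) \<partial>\<mu>)
      * (\<integral>\<^sup>+\<theta>. ennreal (norm (H t \<theta>) * (norm (f (t + s \<theta>)))\<^sup>2) \<partial>\<mu>)"
    by (simp add: ennreal_power power_mult_distrib)
  also have "\<dots> \<le> ennreal A * (\<integral>\<^sup>+\<theta>. ennreal (norm (H t \<theta>) * (norm (f (t + s \<theta>)))\<^sup>2) \<partial>\<mu>)"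
    by (intro mult_right_mono row) simp
  finally show ?thesis .
qed

lemma AE_integrand_integrable:
  assumes f: "f \<in> L2_space lborel"
  shows "AE t in lborel. integrable \<mu> (\<lambda>\<theta>. blinfun_apply (H t \<theta>) (f (t + s \<theta>)))"
proof -
  have fm[measurable]: "f \<in> borel_measurable borel"
    using L2_space_measurable[OF f] by simp
  have "(\<integral>\<^sup>+t. \<integral>\<^sup>+\<theta>. ennreal (norm (H t \<theta>) * (norm (f (t + s \<theta>)))\<^sup>2) \<partial>\<mu> \<partial>lborel) < \<infinity>"
    using f by (intro le_less_trans[OF Schur_bound[OF fm]])
      (auto simp: L2_space_iff ennreal_mult_less_top)
  moreover have "(\<lambda>t. \<integral>\<^sup>+\<theta>. ennreal (norm (H t \<theta>) * (norm (f (t + s \<theta>)))\<^sup>2) \<partial>\<mu>) \<in> borel_measurable lborel"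
  proof (rule \<mu>.borel_measurable_nn_integral)
    have "(\<lambda>z. ennreal (norm (H (fst z) (snd z)) * (norm (f (fst z + s (snd z))))\<^sup>2)) \<in> borel_measurable (lborel \<Otimes>\<^sub>M \<mu>)"
      by measurable
    then show "(\<lambda>(t, \<theta>). ennreal (norm (H t \<theta>) * (norm (f (t + s \<theta>)))\<^sup>2)) \<in> borel_measurable (lborel \<Otimes>\<^sub>M \<mu>)"
      by (simp add: case_prod_beta')
  qed
  ultimately have "AE t in lborel. (\<integral>\<^sup>+\<theta>. ennreal (norm (H t \<theta>) * (norm (f (t + s \<theta>)))\<^sup>2) \<partial>\<mu>) \<noteq> \<infinity>"
    by (intro nn_integral_PInf_AE) auto
  then show ?thesis
  proof eventually_elim
    case (elim t)
    have "(\<integral>\<^sup>+\<theta>. ennreal (norm (blinfun_apply (H t \<theta>) (f (t + s \<theta>)))) \<partial>\<mu>)\<^sup>2 < \<infinity>"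
      using elim by (intro le_less_trans[OF nn_integral_norm_power2_le[OF fm]])
        (auto simp: ennreal_mult_less_top less_top)
    then have "(\<integral>\<^sup>+\<theta>. ennreal (norm (blinfun_apply (H t \<theta>) (f (t + s \<theta>)))) \<partial>\<mu>) < \<infinity>"
      by (simp add: power_less_top_ennreal)
    moreover have "(\<lambda>\<theta>. blinfun_apply (H t \<theta>) (f (t + s \<theta>))) \<in> borel_measurable \<mu>"
      using section_measurable[OF integrand_measurable[OF fm]] by simp
    ultimately show ?case
      by (intro integrableI_bounded)
  qed
qed

lemma nn_integral_op_le:
  assumes f: "f \<in> L2_space lborel"
  shows "(\<integral>\<^sup>+t. ennreal ((norm (op f t))\<^sup>2) \<partial>lborel) \<le> ennreal (A * B * (L2_norm lborel f)\<^sup>2)"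
proof -
  have fm[measurable]: "f \<in> borel_measurable borel"
    using L2_space_measurable[OF f] by simp
  have "AE t in lborel. ennreal ((norm (op f t))\<^sup>2)
      \<le> ennreal A * (\<integral>\<^sup>+\<theta>. ennreal (norm (H t \<theta>) * (norm (f (t + s \<theta>)))\<^sup>2) \<partial>\<mu>)"
    using AE_integrand_integrable[OF f]
  proof eventually_elim
    case (elim t)
    have "ennreal ((norm (op f t))\<^sup>2) = (ennreal (norm (op f t)))\<^sup>2"
      by (simp add: ennreal_power)
    also have "\<dots> \<le> (\<integral>\<^sup>+\<theta>. ennreal (norm (blinfun_apply (H t \<theta>) (f (t + s \<theta>)))) \<partial>\<mu>)\<^sup>2"
      unfolding op_def by (intro power_mono norm_signed_integral_le[OF sm] elim) simp
    also note nn_integral_norm_power2_le[OF fm]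
    finally show ?case .
  qed
  then have "(\<integral>\<^sup>+t. ennreal ((norm (op f t))\<^sup>2) \<partial>lborel)
      \<le> (\<integral>\<^sup>+t. ennreal A * (\<integral>\<^sup>+\<theta>. ennreal (norm (H t \<theta>) * (norm (f (t + s \<theta>)))\<^sup>2) \<partial>\<mu>) \<partial>lborel)"
    by (rule nn_integral_mono_AE)
  also have "\<dots> = ennreal A * (\<integral>\<^sup>+t. \<integral>\<^sup>+\<theta>. ennreal (norm (H t \<theta>) * (norm (f (t + s \<theta>)))\<^sup>2) \<partial>\<mu> \<partial>lborel)"
  proof (rule nn_integral_cmult, rule \<mu>.borel_measurable_nn_integral)
    have "(\<lambda>z. ennreal (norm (H (fst z) (snd z)) * (norm (f (fst z + s (snd z))))\<^sup>2)) \<in> borel_measurable (lborel \<Otimes>\<^sub>M \<mu>)"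
      by measurable
    then show "(\<lambda>(t, \<theta>). ennreal (norm (H t \<theta>) * (norm (f (t + s \<theta>)))\<^sup>2)) \<in> borel_measurable (lborel \<Otimes>\<^sub>M \<mu>)"
      by (simp add: case_prod_beta')
  qed
  also have "\<dots> \<le> ennreal A * (ennreal B * (\<integral>\<^sup>+u. ennreal ((norm (f u))\<^sup>2) \<partial>lborel))"
    by (intro mult_left_mono Schur_bound fm) simp
  also have "\<dots> = ennreal (A * B * (L2_norm lborel f)\<^sup>2)"
    using A_nonneg B_nonneg
    by (simp add: ennreal_L2_norm_power2[OF f, symmetric] ennreal_mult' mult.assoc)
  finally show ?thesis .
qed

lemma op_L2_space:
  assumes f: "f \<in> L2_space lborel"
  shows "op f \<in> L2_space lborel"
  unfolding L2_space_iff
  using op_measurable L2_space_measurable[OF f] le_less_trans[OF nn_integral_op_le[OF f]] by auto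

lemma L2_norm_op_power2_le:
  assumes f: "f \<in> L2_space lborel"
  shows "(L2_norm lborel (op f))\<^sup>2 \<le> A * B * (L2_norm lborel f)\<^sup>2"
proof -
  have "ennreal ((L2_norm lborel (op f))\<^sup>2) \<le> ennreal (A * B * (L2_norm lborel f)\<^sup>2)"
    unfolding ennreal_L2_norm_power2[OF op_L2_space[OF f]] by (rule nn_integral_op_le[OF f])
  then show ?thesis
    using A_nonneg B_nonneg by (simp add: ennreal_le_iff)
qed

lemma L2_norm_op_le:
  assumes f: "f \<in> L2_space lborel"
  shows "L2_norm lborel (op f) \<le> sqrt (A * B) * L2_norm lborel f"
  using real_sqrt_le_mono[OF L2_norm_op_power2_le[OF f]] L2_norm_nonneg[of lborel f]
    L2_norm_nonneg[of lborel "op f"]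
  by (simp add: real_sqrt_mult)

section \<open>Linearity and compatibility with null sets\<close>

lemma op_add:
  assumes f: "f \<in> L2_space lborel" and g: "g \<in> L2_space lborel"
  shows "AE t in lborel. op (\<lambda>u. f u + g u) t = op f t + op g t"
  using AE_integrand_integrable[OF f] AE_integrand_integrable[OF g]
proof eventually_elim
  case (elim t)
  then show ?case
    unfolding op_def blinfun.add_right by (rule signed_integral_add[OF sm])
qed

lemma op_scaleR:
  assumes f: "f \<in> L2_space lborel"
  shows "AE t in lborel. op (\<lambda>u. c *\<^sub>R f u) t = c *\<^sub>R op f t"
  using AE_integrand_integrable[OF f]
proof eventually_elim
  case (elim t)
  show ?case
    using signed_integral_bounded_linear[OF sm bounded_linear_scaleR_right[of c] elim]
    unfolding op_def blinfun.scaleR_right .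
qed

text \<open>The exceptional null set is moved by \<open>s \<theta>\<close>, differently for each
  \<open>\<theta>\<close>. Applying the norm bound to \<open>f - g\<close> avoids following these
  translates.\<close>

lemma op_cong_AE:
  assumes f: "f \<in> L2_space lborel" and g: "g \<in> L2_space lborel" and eq: "AE u in lborel. f u = g u"
  shows "AE t in lborel. op f t = op g t"
proof -
  define h where "h u = f u - g u" for u
  have h: "h \<in> L2_space lborel"
    unfolding h_def using f g by (rule L2_space_diff)
  have "(LINT u|lborel. (norm (h u))\<^sup>2) = 0"
    using eq by (intro integral_eq_zero_AE) (auto simp: h_def)
  then have "L2_norm lborel h = 0"
    by (simp add: L2_norm_def)
  then have "L2_norm lborel (op h) = 0"
    using L2_norm_op_le[OF h] L2_norm_nonneg[of lborel "op h"] by simp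
  then have "AE t in lborel. op h t = 0"
    by (rule L2_norm_zero_AE[OF op_L2_space[OF h]])
  moreover have "AE t in lborel. op (\<lambda>u. g u + h u) t = op g t + op h t"
    by (rule op_add[OF g h])
  moreover have "(\<lambda>u. g u + h u) = f"
    by (simp add: h_def)
  ultimately show ?thesis by auto
qed

lemma L2_bounded_linear_op: "L2_bounded_linear lborel lborel op"
  unfolding L2_bounded_linear_def
  by (intro conjI ballI allI impI exI[of _ "sqrt (A * B)"] op_L2_space op_cong_AE op_add op_scaleR L2_norm_op_le)

text \<open>The rows of the new kernel are the columns of the old one and conversely, so
  \<open>A\<close> and \<open>B\<close> change places; passing to adjoints does not increase the
  operator norm.\<close>

lemma shift_kernel_adjoint:
  "shift_kernel M \<nu> (\<lambda>\<theta>. - s \<theta>) (\<lambda>u \<theta>. adjoint_blinfun (H (u - s \<theta>) \<theta>)) B A"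
proof
  show "(\<lambda>\<theta>. - s \<theta>) \<in> borel_measurable M"
    using s_measurable by simp
  show "(\<lambda>(u, \<theta>). blinfun_apply (adjoint_blinfun (H (u - s \<theta>) \<theta>)) e) \<in> borel_measurable (borel \<Otimes>\<^sub>M M)" for e
    using borel_measurable_adjoint_blinfun[OF H_shift_measurable_pair, of e]
    by (simp add: case_prod_beta' cong: measurable_cong_sets add: sets_pair)
  show "(\<integral>\<^sup>+\<theta>. ennreal (norm (adjoint_blinfun (H (u - s \<theta>) \<theta>))) \<partial>\<mu>) \<le> ennreal B" for u
    by (rule order_trans[OF nn_integral_mono column[of u]]) (simp add: ennreal_leI norm_adjoint_blinfun_le)
  \<comment> \<open>The new column condition undoes the substitution:
    \<open>t - - s \<theta> - s \<theta>\<close> is \<open>t\<close>, which leaves a row of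
    \<open>H\<close>.\<close>
  show "(\<integral>\<^sup>+\<theta>. ennreal (norm (adjoint_blinfun (H (t - - s \<theta> - s \<theta>) \<theta>))) \<partial>\<mu>) \<le> ennreal A" for t
    by (rule order_trans[OF nn_integral_mono row[of t]]) (simp add: ennreal_leI norm_adjoint_blinfun_le)
qed (fact sm A_nonneg B_nonneg)+

text \<open>This is the absolute integrability that Fubini requires. Bounding the product of the
  norms of \<open>f\<close> and \<open>g\<close> by the sum of their squares separates a term
  controlled by the columns (\<open>Schur_bound\<close>) from one controlled by the rows.\<close>

lemma integrable_pair_inner:
  assumes f: "f \<in> L2_space lborel" and g: "g \<in> L2_space lborel"
  shows "integrable (lborel \<Otimes>\<^sub>M \<mu>) (\<lambda>(t, \<theta>). blinfun_apply (H t \<theta>) (f (t + s \<theta>)) \<bullet> g t)"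
proof (rule integrableI_bounded)
  have fm[measurable]: "f \<in> borel_measurable borel" and gm[measurable]: "g \<in> borel_measurable borel"
    using L2_space_measurable[OF f] L2_space_measurable[OF g] by simp_all
  note [measurable] = integrand_measurable[OF fm]
  let ?G = "\<lambda>z. blinfun_apply (H (fst z) (snd z)) (f (fst z + s (snd z))) \<bullet> g (fst z)"
  let ?U = "\<lambda>z. ennreal (norm (H (fst z) (snd z)) * (norm (f (fst z + s (snd z))))\<^sup>2)"
  let ?V = "\<lambda>z. ennreal (norm (H (fst z) (snd z)) * (norm (g (fst z)))\<^sup>2)"
  have U[measurable]: "?U \<in> borel_measurable (lborel \<Otimes>\<^sub>M \<mu>)"
    and V[measurable]: "?V \<in> borel_measurable (lborel \<Otimes>\<^sub>M \<mu>)"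
    by measurable
  have "?G \<in> borel_measurable (lborel \<Otimes>\<^sub>M \<mu>)"
    by measurable
  then show "(\<lambda>(t, \<theta>). blinfun_apply (H t \<theta>) (f (t + s \<theta>)) \<bullet> g t) \<in> borel_measurable (lborel \<Otimes>\<^sub>M \<mu>)"
    by (simp add: case_prod_beta')
  have "norm (blinfun_apply L v \<bullet> w) \<le> norm L * (norm v)\<^sup>2 + norm L * (norm w)\<^sup>2"
    for L :: "'e \<Rightarrow>\<^sub>L 'f" and v w
  proof -
    have "norm (blinfun_apply L v \<bullet> w) \<le> norm (blinfun_apply L v) * norm w"
      by (simp add: Cauchy_Schwarz_ineq2)
    also have "\<dots> \<le> (norm L * norm v) * norm w"
      by (intro mult_right_mono norm_blinfun) simp
    also have "\<dots> = norm L * (norm v * norm w)"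
      by simp
    also have "\<dots> \<le> norm L * ((norm v)\<^sup>2 + (norm w)\<^sup>2)"
    proof (rule mult_left_mono)
      show "norm v * norm w \<le> (norm v)\<^sup>2 + (norm w)\<^sup>2"
        using sum_squares_bound[of "norm v" "norm w"]
          mult_nonneg_nonneg[OF norm_ge_zero[of v] norm_ge_zero[of w]] by linarith
    qed simp
    finally show ?thesis by (simp add: distrib_left)
  qed
  then have "(\<integral>\<^sup>+z. ennreal (norm (?G z)) \<partial>(lborel \<Otimes>\<^sub>M \<mu>)) \<le> (\<integral>\<^sup>+z. ?U z + ?V z \<partial>(lborel \<Otimes>\<^sub>M \<mu>))"
    by (intro nn_integral_mono) (simp add: ennreal_leI flip: ennreal_plus)
  also have "\<dots> = (\<integral>\<^sup>+z. ?U z \<partial>(lborel \<Otimes>\<^sub>M \<mu>)) + (\<integral>\<^sup>+z. ?V z \<partial>(lborel \<Otimes>\<^sub>M \<mu>))"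
    by (rule nn_integral_add[OF U V])
  also have "\<dots> < \<infinity>"
  proof -
    have "(\<integral>\<^sup>+z. ?U z \<partial>(lborel \<Otimes>\<^sub>M \<mu>)) = (\<integral>\<^sup>+t. \<integral>\<^sup>+\<theta>. ?U (t, \<theta>) \<partial>\<mu> \<partial>lborel)"
      by (rule \<mu>.nn_integral_fst[OF U, symmetric])
    also have "\<dots> < \<infinity>"
      using f Schur_bound[OF fm] by (auto simp: L2_space_iff ennreal_mult_less_top intro: le_less_trans)
    finally have fin_U: "(\<integral>\<^sup>+z. ?U z \<partial>(lborel \<Otimes>\<^sub>M \<mu>)) < \<infinity>" .
    have "(\<integral>\<^sup>+z. ?V z \<partial>(lborel \<Otimes>\<^sub>M \<mu>)) = (\<integral>\<^sup>+t. \<integral>\<^sup>+\<theta>. ?V (t, \<theta>) \<partial>\<mu> \<partial>lborel)"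
      by (rule \<mu>.nn_integral_fst[OF V, symmetric])
    also have "\<dots> = (\<integral>\<^sup>+t. (\<integral>\<^sup>+\<theta>. ennreal (norm (H t \<theta>)) \<partial>\<mu>) * ennreal ((norm (g t))\<^sup>2) \<partial>lborel)"
      using section_measurable[OF norm_H_measurable(1)]
      by (simp add: ennreal_mult nn_integral_multc)
    also have "\<dots> \<le> (\<integral>\<^sup>+t. ennreal A * ennreal ((norm (g t))\<^sup>2) \<partial>lborel)"
      by (intro nn_integral_mono mult_right_mono row) simp
    also have "\<dots> = ennreal A * (\<integral>\<^sup>+t. ennreal ((norm (g t))\<^sup>2) \<partial>lborel)"
      by (simp add: nn_integral_cmult)
    also have "\<dots> < \<infinity>"
      using g by (auto simp: L2_space_iff ennreal_mult_less_top)
    finally show ?thesis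
      using fin_U by simp
  qed
  finally show "(\<integral>\<^sup>+z. ennreal (norm (case z of (t, \<theta>) \<Rightarrow> blinfun_apply (H t \<theta>) (f (t + s \<theta>)) \<bullet> g t)) \<partial>(lborel \<Otimes>\<^sub>M \<mu>)) < \<infinity>"
    by (simp add: case_prod_beta')
qed

text \<open>The inner product with \<open>g t\<close> is bounded and linear, so it moves under the
  signed integral and leaves a real integrand for Fubini.\<close>

lemma L2_inner_op:
  assumes f: "f \<in> L2_space lborel" and g: "g \<in> L2_space lborel"
  shows "L2_inner lborel (op f) g =
    signed_integral M \<nu> (\<lambda>\<theta>. LINT t|lborel. blinfun_apply (H t \<theta>) (f (t + s \<theta>)) \<bullet> g t)"
proof -
  note int = integrable_pair_inner[OF f g]
  have "AE t in lborel. op f t \<bullet> g t =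
      signed_integral M \<nu> (\<lambda>\<theta>. blinfun_apply (H t \<theta>) (f (t + s \<theta>)) \<bullet> g t)"
    using AE_integrand_integrable[OF f]
  proof eventually_elim
    case (elim t)
    show ?case
      unfolding op_def
      using signed_integral_bounded_linear[OF sm bounded_linear_inner_left[of "g t"] elim] by simp
  qed
  moreover have "(\<lambda>t. op f t \<bullet> g t) \<in> borel_measurable lborel"
    by (intro borel_measurable_inner L2_space_measurable op_L2_space f g)
  moreover have "(\<lambda>t. signed_integral M \<nu> (\<lambda>\<theta>. blinfun_apply (H t \<theta>) (f (t + s \<theta>)) \<bullet> g t))
      \<in> borel_measurable lborel"
    using borel_measurable_integrable[OF int]
    by (intro borel_measurable_signed_integral[OF sm])
       (simp cong: measurable_cong_sets sets_pair_measure_cong add: sets_\<mu>)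
  ultimately have "L2_inner lborel (op f) g =
      (LINT t|lborel. signed_integral M \<nu> (\<lambda>\<theta>. blinfun_apply (H t \<theta>) (f (t + s \<theta>)) \<bullet> g t))"
    unfolding L2_inner_def by (intro integral_cong_AE)
  also have "\<dots> = signed_integral M \<nu> (\<lambda>\<theta>. LINT t|lborel. blinfun_apply (H t \<theta>) (f (t + s \<theta>)) \<bullet> g t)"
    by (rule Fubini_signed_integral[OF sm _ int]) (rule lborel.sigma_finite_measure_axioms)
  finally show ?thesis .
qed

definition adjoint_op :: "(real \<Rightarrow> 'f) \<Rightarrow> real \<Rightarrow> 'e" where
  "adjoint_op = shift_kernel.op M \<nu> (\<lambda>\<theta>. - s \<theta>) (\<lambda>u \<theta>. adjoint_blinfun (H (u - s \<theta>) \<theta>))"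

text \<open>\<open>L2_inner_op\<close>, used for the kernel and for its adjoint, writes both sides
  as signed integrals over \<open>\<theta>\<close>. It remains to compare the Lebesgue integrals for
  a single \<open>\<theta>\<close>, which is a translation followed by the adjoint equation.\<close>

theorem L2_inner_adjoint_op:
  assumes f: "f \<in> L2_space lborel" and g: "g \<in> L2_space lborel"
  shows "L2_inner lborel (op f) g = L2_inner lborel f (adjoint_op g)"
proof -
  interpret adj: shift_kernel M \<nu> "\<lambda>\<theta>. - s \<theta>" "\<lambda>u \<theta>. adjoint_blinfun (H (u - s \<theta>) \<theta>)" B A
    by (rule shift_kernel_adjoint)
  have "(LINT t|lborel. blinfun_apply (H t \<theta>) (f (t + s \<theta>)) \<bullet> g t) =
      (LINT u|lborel. blinfun_apply (adjoint_blinfun (H (u - s \<theta>) \<theta>)) (g (u + - s \<theta>)) \<bullet> f u)" for \<theta>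
    by (subst lborel_integral_real_affine[of 1 _ "- s \<theta>"])
       (simp_all add: inner_commute[of "blinfun_apply (adjoint_blinfun _) _"] inner_adjoint_blinfun add.commute)
  then have "L2_inner lborel (op f) g = L2_inner lborel (adj.op g) f"
    unfolding L2_inner_op[OF f g] adj.L2_inner_op[OF g f] by simp
  then show ?thesis
    by (simp add: L2_inner_def inner_commute adjoint_op_def)
qed

end

section \<open>Restriction to intervals\<close>

definition zero_extend :: "'a set \<Rightarrow> ('a \<Rightarrow> 'b::real_vector) \<Rightarrow> 'a \<Rightarrow> 'b" where
  "zero_extend \<Omega> f x = indicator \<Omega> x *\<^sub>R f x"

lemma zero_extend_in [simp]: "x \<in> \<Omega> \<Longrightarrow> zero_extend \<Omega> f x = f x"
  and zero_extend_notin [simp]: "x \<notin> \<Omega> \<Longrightarrow> zero_extend \<Omega> f x = 0"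
  by (simp_all add: zero_extend_def)

context
  fixes M :: "'a measure" and \<Omega> :: "'a set"
  assumes \<Omega>: "\<Omega> \<in> sets M"
begin

lemma restrict_sets: "\<Omega> \<inter> space M \<in> sets M"
  using \<Omega> by simp

lemma L2_space_restrict_space_iff:
  fixes f :: "'a \<Rightarrow> 'b::real_inner"
  shows "f \<in> L2_space (restrict_space M \<Omega>) \<longleftrightarrow> zero_extend \<Omega> f \<in> L2_space M"
proof -
  have "indicator \<Omega> x *\<^sub>R (norm (f x))\<^sup>2 = (norm (zero_extend \<Omega> f x))\<^sup>2" for x
    by (cases "x \<in> \<Omega>") auto
  then show ?thesis
    unfolding L2_space_def
    by (simp add: borel_measurable_restrict_space_iff[OF restrict_sets] integrable_restrict_space[OF restrict_sets]
        zero_extend_def[abs_def])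
qed

lemma L2_inner_restrict_space:
  fixes f g :: "'a \<Rightarrow> 'b::real_inner"
  shows "L2_inner (restrict_space M \<Omega>) f g = L2_inner M (zero_extend \<Omega> f) (zero_extend \<Omega> g)"
proof -
  have "indicator \<Omega> x *\<^sub>R (f x \<bullet> g x) = zero_extend \<Omega> f x \<bullet> zero_extend \<Omega> g x" for x
    by (cases "x \<in> \<Omega>") auto
  then show ?thesis
    by (simp add: L2_inner_def integral_restrict_space[OF restrict_sets])
qed

lemma L2_norm_restrict_space:
  fixes f :: "'a \<Rightarrow> 'b::real_inner"
  shows "L2_norm (restrict_space M \<Omega>) f = L2_norm M (zero_extend \<Omega> f)"
  using L2_inner_restrict_space[of f f] by (simp add: L2_norm_def L2_inner_def power2_norm_eq_inner)

lemma L2_space_zero_extend: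
  fixes f :: "'a \<Rightarrow> 'b::{real_inner, second_countable_topology}"
  assumes "f \<in> L2_space M"
  shows "zero_extend \<Omega> f \<in> L2_space M"
proof -
  have [measurable]: "f \<in> borel_measurable M" "\<Omega> \<in> sets M"
    using assms \<Omega> by (auto simp: L2_space_def)
  have meas: "zero_extend \<Omega> f \<in> borel_measurable M"
    unfolding zero_extend_def[abs_def] by measurable
  have "integrable M (\<lambda>x. (norm (f x))\<^sup>2)"
    using assms by (simp add: L2_space_def)
  then have "integrable M (\<lambda>x. (norm (zero_extend \<Omega> f x))\<^sup>2)"
  proof (rule Bochner_Integration.integrable_bound)
    show "AE x in M. norm ((norm (zero_extend \<Omega> f x))\<^sup>2) \<le> norm ((norm (f x))\<^sup>2)"
      by (intro AE_I2) (auto simp: zero_extend_def indicator_def)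
  qed (use meas in measurable)
  then show ?thesis
    using meas by (simp add: L2_space_def)
qed

lemma L2_norm_zero_extend_le:
  fixes f :: "'a \<Rightarrow> 'b::{real_inner, second_countable_topology}"
  assumes "f \<in> L2_space M"
  shows "L2_norm M (zero_extend \<Omega> f) \<le> L2_norm M f"
  unfolding L2_norm_def
proof (intro real_sqrt_le_mono integral_mono)
  show "integrable M (\<lambda>x. (norm (zero_extend \<Omega> f x))\<^sup>2)" "integrable M (\<lambda>x. (norm (f x))\<^sup>2)"
    using assms L2_space_zero_extend[OF assms] by (simp_all add: L2_space_def)
  show "(norm (zero_extend \<Omega> f x))\<^sup>2 \<le> (norm (f x))\<^sup>2" for x
    by (auto simp: zero_extend_def indicator_def)
qed

lemma L2_inner_zero_extend:
  fixes f g :: "'a \<Rightarrow> 'b::real_inner"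
  shows "L2_inner M (zero_extend \<Omega> f) (zero_extend \<Omega> g) = L2_inner M f (zero_extend \<Omega> g)"
proof -
  have "zero_extend \<Omega> f x \<bullet> zero_extend \<Omega> g x = f x \<bullet> zero_extend \<Omega> g x" for x
    by (cases "x \<in> \<Omega>") auto
  then show ?thesis by (simp add: L2_inner_def)
qed

end

text \<open>\<open>S\<close> is the compression of \<open>T\<close>: extend by zero, apply
  \<open>T\<close>, restrict. The relation is required only on \<open>\<Omega>'\<close>, because
  \<open>lag_operator\<close> agrees with the operator of the cut-off kernel only for times in
  [0,T].\<close>

lemma L2_bounded_linear_restrict_space:
  fixes T :: "('a \<Rightarrow> 'b::{real_inner, second_countable_topology}) \<Rightarrow> 'c \<Rightarrow> 'd::{real_inner, second_countable_topology}"
  assumes \<Omega>: "\<Omega> \<in> sets M" and \<Omega>': "\<Omega>' \<in> sets N"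
    and T: "L2_bounded_linear M N T"
    and S: "\<And>f y. y \<in> \<Omega>' \<Longrightarrow> S f y = T (zero_extend \<Omega> f) y"
  shows "L2_bounded_linear (restrict_space M \<Omega>) (restrict_space N \<Omega>') S"
proof -
  note AE_M = AE_restrict_space_iff[OF restrict_sets[OF \<Omega>]]
  note AE_N = AE_restrict_space_iff[OF restrict_sets[OF \<Omega>']]
  note L2 = L2_space_restrict_space_iff[OF \<Omega>] L2_space_restrict_space_iff[OF \<Omega>']
  note norm = L2_norm_restrict_space[OF \<Omega>] L2_norm_restrict_space[OF \<Omega>']
  have ext_S: "zero_extend \<Omega>' (S f) = zero_extend \<Omega>' (T (zero_extend \<Omega> f))" for f
    by (rule ext) (auto simp: zero_extend_def indicator_def S)
  have add: "zero_extend \<Omega> (\<lambda>x. f x + g x) = (\<lambda>x. zero_extend \<Omega> f x + zero_extend \<Omega> g x)" for f g :: "'a \<Rightarrow> 'b"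
    by (rule ext) (simp add: zero_extend_def scaleR_add_right)
  have scale: "zero_extend \<Omega> (\<lambda>x. c *\<^sub>R f x) = (\<lambda>x. c *\<^sub>R zero_extend \<Omega> f x)" for c and f :: "'a \<Rightarrow> 'b"
    by (rule ext) (simp add: zero_extend_def)
  obtain C where C: "\<And>f. f \<in> L2_space M \<Longrightarrow> L2_norm N (T f) \<le> C * L2_norm M f"
    using T unfolding L2_bounded_linear_def by blast
  have T_L2: "\<And>f. f \<in> L2_space M \<Longrightarrow> T f \<in> L2_space N"
    and T_cong: "\<And>f g. f \<in> L2_space M \<Longrightarrow> g \<in> L2_space M \<Longrightarrow> AE x in M. f x = g x \<Longrightarrow> AE y in N. T f y = T g y"
    and T_add: "\<And>f g. f \<in> L2_space M \<Longrightarrow> g \<in> L2_space M \<Longrightarrow> AE y in N. T (\<lambda>x. f x + g x) y = T f y + T g y"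
    and T_scale: "\<And>c f. f \<in> L2_space M \<Longrightarrow> AE y in N. T (\<lambda>x. c *\<^sub>R f x) y = c *\<^sub>R T f y"
    using T unfolding L2_bounded_linear_def by blast+
  show ?thesis
    unfolding L2_bounded_linear_def L2 norm AE_M AE_N
  proof (intro conjI ballI allI impI exI[of _ C])
    fix f :: "'a \<Rightarrow> 'b" assume f: "f \<in> L2_space (restrict_space M \<Omega>)"
    then have f': "zero_extend \<Omega> f \<in> L2_space M"
      by (simp add: L2)
    show "zero_extend \<Omega>' (S f) \<in> L2_space N"
      unfolding ext_S by (intro L2_space_zero_extend \<Omega>' T_L2 f')
    show "AE y in N. y \<in> \<Omega>' \<longrightarrow> S (\<lambda>x. c *\<^sub>R f x) y = c *\<^sub>R S f y" for c
      using T_scale[OF f', of c] by eventually_elim (simp add: S scale)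
    have "L2_norm N (zero_extend \<Omega>' (S f)) \<le> L2_norm N (T (zero_extend \<Omega> f))"
      unfolding ext_S by (intro L2_norm_zero_extend_le \<Omega>' T_L2 f')
    then show "L2_norm N (zero_extend \<Omega>' (S f)) \<le> C * L2_norm M (zero_extend \<Omega> f)"
      using C[OF f'] by simp
    fix g :: "'a \<Rightarrow> 'b" assume "g \<in> L2_space (restrict_space M \<Omega>)"
    then have g': "zero_extend \<Omega> g \<in> L2_space M"
      by (simp add: L2)
    show "AE y in N. y \<in> \<Omega>' \<longrightarrow> S (\<lambda>x. f x + g x) y = S f y + S g y"
      using T_add[OF f' g'] by eventually_elim (simp add: S add)
    assume eq: "AE x in M. x \<in> \<Omega> \<longrightarrow> f x = g x"
    have "AE x in M. zero_extend \<Omega> f x = zero_extend \<Omega> g x"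
      using eq by eventually_elim (auto simp: zero_extend_def indicator_def)
    from T_cong[OF f' g' this]
    show "AE y in N. y \<in> \<Omega>' \<longrightarrow> S f y = S g y"
      by eventually_elim (simp add: S)
  qed
qed

lemma L2_adjoint_unique:
  fixes A :: "('a \<Rightarrow> 'b::{real_inner, second_countable_topology}) \<Rightarrow> 'c \<Rightarrow> 'd::real_inner"
  assumes B: "is_L2_adjoint M N A B" and C: "is_L2_adjoint M N A C" and g: "g \<in> L2_space N"
  shows "AE x in M. B g x = C g x"
proof (rule L2_eqI_inner)
  show "B g \<in> L2_space M" "C g \<in> L2_space M"
    using B C g by (auto simp: is_L2_adjoint_def L2_bounded_linear_def)
  show "L2_inner M f (B g) = L2_inner M f (C g)" if "f \<in> L2_space M" for f
  proof -
    have "L2_inner M f (B g) = L2_inner N (A f) g"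
      using B that g by (simp add: is_L2_adjoint_def)
    also have "\<dots> = L2_inner M f (C g)"
      using C that g by (simp add: is_L2_adjoint_def)
    finally show ?thesis .
  qed
qed

lemma L2_norm_cong_AE:
  assumes "f \<in> borel_measurable M" "g \<in> borel_measurable M" "AE x in M. f x = g x"
  shows "L2_norm M f = L2_norm M g"
  unfolding L2_norm_def using assms
  by (intro arg_cong[of _ _ sqrt] integral_cong_AE) (auto elim: eventually_mono)

section \<open>The lag operator and its adjoint\<close>

definition lag_adjoint :: "real \<Rightarrow> (real set \<Rightarrow> real) \<Rightarrow>
    (real \<Rightarrow> real \<Rightarrow> 'e::{real_inner, banach, second_countable_topology} \<Rightarrow>\<^sub>L 'f::real_inner) \<Rightarrow>
    (real \<Rightarrow> 'f) \<Rightarrow> real \<Rightarrow> 'e" where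
  "lag_adjoint T \<alpha> K Q u = signed_integral half_line \<alpha>
     (\<lambda>\<theta>. indicator {0..T} (u + \<theta>) *\<^sub>R adjoint (blinfun_apply (K (u + \<theta>) \<theta>)) (Q (u + \<theta>)))"

locale finite_lag_kernel =
  fixes T :: real and \<alpha> :: "real set \<Rightarrow> real"
    and K :: "real \<Rightarrow> real \<Rightarrow> 'e::{real_inner, banach, second_countable_topology}
       \<Rightarrow>\<^sub>L 'f::{real_inner, banach, second_countable_topology}"
  assumes T_nonneg: "0 \<le> T"
    and \<alpha>: "signed_measure half_line \<alpha>"
    and K_measurable: "\<And>e. (\<lambda>(t, \<theta>). blinfun_apply (K t \<theta>) e)
        \<in> borel_measurable (restrict_space borel {0..T} \<Otimes>\<^sub>M half_line)"
    and M0_finite: "lag_M0 T \<alpha> K < \<infinity>" and M_finite: "lag_M T \<alpha> K < \<infinity>"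
begin

text \<open>\<open>K\<close> is arbitrary outside [0,T], whereas the locale demands measurability
  and bounds for all real times; the cut-off provides both.\<close>

definition K0 :: "real \<Rightarrow> real \<Rightarrow> 'e \<Rightarrow>\<^sub>L 'f" where
  "K0 t \<theta> = indicator {0..T} t *\<^sub>R K t \<theta>"

abbreviation "M0 \<equiv> enn2real (lag_M0 T \<alpha> K)"
abbreviation "M1 \<equiv> enn2real (lag_M T \<alpha> K)"

sublocale shift_kernel half_line \<alpha> uminus K0 M0 M1
proof
  show "(\<lambda>(t, \<theta>). blinfun_apply (K0 t \<theta>) e) \<in> borel_measurable (borel \<Otimes>\<^sub>M half_line)" for e
  proof -
    \<comment> \<open>A measurable retraction of the line to [0,T], through which the measurability
      of \<open>K\<close> is pulled back; the indicator removes the values produced by the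
      placeholder 0.\<close>
    define c where "c t = (if t \<in> {0..T} then t else 0)" for t
    have "c \<in> measurable borel (restrict_space borel {0..T})"
      using T_nonneg by (intro measurable_restrict_space2) (auto simp: c_def[abs_def])
    then have "(\<lambda>z. (c (fst z), snd z)) \<in> measurable (borel \<Otimes>\<^sub>M half_line) (restrict_space borel {0..T} \<Otimes>\<^sub>M half_line)"
      by measurable
    from measurable_compose[OF this K_measurable[of e]]
    have [measurable]: "(\<lambda>z. blinfun_apply (K (c (fst z)) (snd z)) e) \<in> borel_measurable (borel \<Otimes>\<^sub>M half_line)"
      by simp
    have "(\<lambda>z. indicator {0..T} (fst z) *\<^sub>R blinfun_apply (K (c (fst z)) (snd z)) e)
        \<in> borel_measurable (borel \<Otimes>\<^sub>M half_line)"
      by measurable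
    moreover have "indicator {0..T} (fst z) *\<^sub>R blinfun_apply (K (c (fst z)) (snd z)) e =
        (case z of (t, \<theta>) \<Rightarrow> blinfun_apply (K0 t \<theta>) e)" for z
      by (auto simp: K0_def c_def indicator_def blinfun.scaleR_left split: prod.split)
    ultimately show ?thesis by simp
  qed
  show "(\<integral>\<^sup>+\<theta>. ennreal (norm (K0 t \<theta>)) \<partial>tv_measure half_line \<alpha>) \<le> ennreal M0" for t
  proof (cases "t \<in> {0..T}")
    case True
    then have "(\<integral>\<^sup>+\<theta>. ennreal (norm (K0 t \<theta>)) \<partial>tv_measure half_line \<alpha>)
        = (\<integral>\<^sup>+\<theta>. ennreal (norm (K t \<theta>)) \<partial>tv_measure half_line \<alpha>)"
      by (simp add: K0_def)
    also have "\<dots> \<le> lag_M0 T \<alpha> K"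
      unfolding lag_M0_def by (rule SUP_upper[OF True])
    finally show ?thesis
      using M0_finite by simp
  qed (simp add: K0_def)
  show "(\<integral>\<^sup>+\<theta>. ennreal (norm (K0 (u - - \<theta>) \<theta>)) \<partial>tv_measure half_line \<alpha>) \<le> ennreal M1" for u
  proof -
    have "(\<integral>\<^sup>+\<theta>. ennreal (norm (K0 (u - - \<theta>) \<theta>)) \<partial>tv_measure half_line \<alpha>)
       = (\<integral>\<^sup>+\<theta>. ennreal (norm (K (u + \<theta>) \<theta>)) * indicator {0..T} (u + \<theta>) \<partial>tv_measure half_line \<alpha>)"
      by (intro nn_integral_cong) (simp add: K0_def indicator_def)
    also have "\<dots> \<le> lag_M T \<alpha> K"
    proof (cases "u \<le> T")
      case True
      then show ?thesis
        unfolding lag_M_def by (intro SUP_upper) simp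
    next
      case False
      \<comment> \<open>The supremum in \<open>lag_M\<close> stops at \<open>T\<close>. Beyond it,
        \<open>u + \<theta>\<close> with \<open>\<theta> \<ge> 0\<close> never returns to [0,T], so
        the column is zero.\<close>
      have "ennreal (norm (K (u + \<theta>) \<theta>)) * indicator {0..T} (u + \<theta>) = 0"
        if "\<theta> \<in> space (tv_measure half_line \<alpha>)" for \<theta>
        using that False by (auto simp: space_tv_measure[OF \<alpha>] space_restrict_space indicator_def)
      then have "(\<integral>\<^sup>+\<theta>. ennreal (norm (K (u + \<theta>) \<theta>)) * indicator {0..T} (u + \<theta>) \<partial>tv_measure half_line \<alpha>)
          = (\<integral>\<^sup>+\<theta>. 0 \<partial>tv_measure half_line \<alpha>)"
        by (rule nn_integral_cong)
      then show ?thesis by simp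
    qed
    finally show ?thesis
      using M_finite by simp
  qed
  show "uminus \<in> borel_measurable half_line"
    by (intro measurable_restrict_space1) measurable
qed (simp_all add: \<alpha>)

lemma space_\<mu>: "space \<mu> = {0..}"
  by (simp add: space_tv_measure[OF \<alpha>] space_restrict_space)

text \<open>For \<open>t \<le> T\<close> and nonnegative lag the time \<open>t - \<theta>\<close>
  stays below \<open>T\<close>, so neither cut-off is active.\<close>

lemma K0_zero_extend:
  assumes "t \<in> {0..T}" "0 \<le> \<theta>"
  shows "blinfun_apply (K0 t \<theta>) (zero_extend {..T} Z (t + - \<theta>)) = blinfun_apply (K t \<theta>) (Z (t - \<theta>))"
  using assms by (simp add: K0_def)

lemma lag_operator_eq_op:
  assumes "t \<in> {0..T}"
  shows "lag_operator \<alpha> K Z t = op (zero_extend {..T} Z) t"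
  unfolding lag_operator_def op_def
  using assms K0_zero_extend by (intro signed_integral_cong[OF \<alpha>]) (simp add: space_restrict_space)

text \<open>The double negations are kept as \<open>shift_kernel_adjoint\<close> produces them, so
  that \<open>adj.op\<close> is \<open>adjoint_op\<close> by mere unfolding.\<close>

sublocale adj: shift_kernel half_line \<alpha> "\<lambda>\<theta>. - (- \<theta>)" "\<lambda>u \<theta>. adjoint_blinfun (K0 (u - - \<theta>) \<theta>)" M1 M0
  by (rule shift_kernel_adjoint)

lemma adjoint_op_eq: "adjoint_op = adj.op"
  by (simp add: adjoint_op_def)

lemma adjoint_K0_zero_extend:
  "blinfun_apply (adjoint_blinfun (K0 (u - - \<theta>) \<theta>)) (zero_extend {0..T} Q (u + - (- \<theta>))) =
    indicator {0..T} (u + \<theta>) *\<^sub>R adjoint (blinfun_apply (K (u + \<theta>) \<theta>)) (Q (u + \<theta>))"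
  by (cases "u + \<theta> \<in> {0..T}")
     (simp_all add: K0_def adjoint_blinfun_apply[symmetric] blinfun.zero_right)

lemma lag_adjoint_eq_op: "lag_adjoint T \<alpha> K Q u = adjoint_op (zero_extend {0..T} Q) u"
  unfolding lag_adjoint_def adjoint_op_eq adj.op_def adjoint_K0_zero_extend ..

lemma interval_sets: "{..T} \<in> sets lborel" "{0..T} \<in> sets lborel"
  by simp_all

lemma L2_bounded_linear_lag_operator: "L2_bounded_linear (past T) (horizon T) (lag_operator \<alpha> K)"
  by (rule L2_bounded_linear_restrict_space[OF interval_sets L2_bounded_linear_op])
     (rule lag_operator_eq_op)

lemma L2_bounded_linear_lag_adjoint: "L2_bounded_linear (horizon T) (past T) (lag_adjoint T \<alpha> K)"
  by (rule L2_bounded_linear_restrict_space[OF interval_sets(2,1) adj.L2_bounded_linear_op])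
     (simp add: lag_adjoint_eq_op adjoint_op_eq)

lemma AE_lag_operator_integrable:
  assumes "Z \<in> L2_space (past T)"
  shows "AE t in horizon T. integrable \<mu> (\<lambda>\<theta>. blinfun_apply (K t \<theta>) (Z (t - \<theta>)))"
proof -
  have "zero_extend {..T} Z \<in> L2_space lborel"
    using assms by (simp add: L2_space_restrict_space_iff)
  from AE_integrand_integrable[OF this]
  have "AE t in lborel. t \<in> {0..T} \<longrightarrow> integrable \<mu> (\<lambda>\<theta>. blinfun_apply (K t \<theta>) (Z (t - \<theta>)))"
  proof eventually_elim
    case (elim t)
    show ?case
    proof
      assume t: "t \<in> {0..T}"
      show "integrable \<mu> (\<lambda>\<theta>. blinfun_apply (K t \<theta>) (Z (t - \<theta>)))"
        using elim by (rule Bochner_Integration.integrable_cong[OF refl, THEN iffD1, rotated])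
          (rule K0_zero_extend[OF t], simp add: space_\<mu>)
    qed
  qed
  then show ?thesis
    by (simp add: AE_restrict_space_iff)
qed

lemma AE_lag_adjoint_integrable:
  assumes "Q \<in> L2_space (horizon T)"
  shows "AE u in past T. integrable \<mu>
    (\<lambda>\<theta>. indicator {0..T} (u + \<theta>) *\<^sub>R adjoint (blinfun_apply (K (u + \<theta>) \<theta>)) (Q (u + \<theta>)))"
proof -
  have "zero_extend {0..T} Q \<in> L2_space lborel"
    using assms by (simp add: L2_space_restrict_space_iff)
  from adj.AE_integrand_integrable[OF this] show ?thesis
    unfolding adjoint_K0_zero_extend by (simp add: AE_restrict_space_iff) (auto elim: eventually_mono)
qed

lemma is_L2_adjoint_lag_adjoint:
  "is_L2_adjoint (past T) (horizon T) (lag_operator \<alpha> K) (lag_adjoint T \<alpha> K)"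
  unfolding is_L2_adjoint_def
proof (intro conjI ballI L2_bounded_linear_lag_adjoint)
  fix Z :: "real \<Rightarrow> 'e" and Q :: "real \<Rightarrow> 'f"
  assume Z: "Z \<in> L2_space (past T)" and Q: "Q \<in> L2_space (horizon T)"
  let ?Z = "zero_extend {..T} Z" and ?Q = "zero_extend {0..T} Q"
  have Z': "?Z \<in> L2_space lborel" and Q': "?Q \<in> L2_space lborel"
    using Z Q by (simp_all add: L2_space_restrict_space_iff)
  have "zero_extend {0..T} (lag_operator \<alpha> K Z) = zero_extend {0..T} (op ?Z)"
    by (rule ext) (auto simp: zero_extend_def indicator_def lag_operator_eq_op)
  then have "L2_inner (horizon T) (lag_operator \<alpha> K Z) Q = L2_inner lborel (op ?Z) ?Q"
    by (simp add: L2_inner_restrict_space L2_inner_zero_extend)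
  also have "\<dots> = L2_inner lborel ?Z (adjoint_op ?Q)"
    by (rule L2_inner_adjoint_op[OF Z' Q'])
  \<comment> \<open>\<open>?Z\<close> vanishes beyond \<open>T\<close>, so cutting off the second
    factor there does not change the inner product.\<close>
  also have "\<dots> = L2_inner lborel ?Z (zero_extend {..T} (lag_adjoint T \<alpha> K Q))"
    using L2_inner_zero_extend[OF interval_sets(1), of "adjoint_op ?Q" Z]
    by (simp add: L2_inner_def inner_commute lag_adjoint_eq_op[abs_def])
  finally show "L2_inner (horizon T) (lag_operator \<alpha> K Z) Q = L2_inner (past T) Z (lag_adjoint T \<alpha> K Q)"
    by (simp add: L2_inner_restrict_space)
qed

lemma L2_norm_lag_adjoint_power2_le:
  assumes "Q \<in> L2_space (horizon T)"
  shows "(L2_norm (past T) (lag_adjoint T \<alpha> K Q))\<^sup>2 \<le> M0 * M1 * (L2_norm (horizon T) Q)\<^sup>2"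
proof -
  let ?Q = "zero_extend {0..T} Q"
  have Q': "?Q \<in> L2_space lborel"
    using assms by (simp add: L2_space_restrict_space_iff)
  have "L2_norm (past T) (lag_adjoint T \<alpha> K Q) = L2_norm lborel (zero_extend {..T} (adj.op ?Q))"
    by (simp add: L2_norm_restrict_space lag_adjoint_eq_op[abs_def] adjoint_op_eq)
  also have "\<dots> \<le> L2_norm lborel (adj.op ?Q)"
    by (rule L2_norm_zero_extend_le[OF interval_sets(1) adj.op_L2_space[OF Q']])
  finally have "(L2_norm (past T) (lag_adjoint T \<alpha> K Q))\<^sup>2 \<le> (L2_norm lborel (adj.op ?Q))\<^sup>2"
    by (rule power_mono) (rule L2_norm_nonneg)
  also have "\<dots> \<le> M1 * M0 * (L2_norm lborel ?Q)\<^sup>2"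
    by (rule adj.L2_norm_op_power2_le[OF Q'])
  finally show ?thesis
    by (simp add: L2_norm_restrict_space mult.commute)
qed

end

theorem theorem3p9:
  fixes T lam :: real
    and \<alpha> :: "real set \<Rightarrow> real"
    and a :: "real \<Rightarrow> (real \<Rightarrow> 'e::{real_inner, banach, second_countable_topology}) \<Rightarrow>
                'f::{real_inner, banach, second_countable_topology}"
    and x :: "real \<Rightarrow> 'e"
    and \<rho> :: "real \<Rightarrow> (real \<Rightarrow> 'e) \<Rightarrow> 'f"
    and K :: "real \<Rightarrow> real \<Rightarrow> 'e \<Rightarrow>\<^sub>L 'f"
  assumes "T > 0" and "lam > 0"
    and "signed_measure half_line \<alpha>"
    and "lag_kernel lam T \<alpha> a x \<rho> K"
  shows
    "L2_bounded_linear (past T) (horizon T) (lag_operator \<alpha> K) \<and>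
     (\<forall>Z\<in>L2_space (past T). AE t in horizon T.
        integrable (tv_measure half_line \<alpha>) (\<lambda>\<theta>. blinfun_apply (K t \<theta>) (Z (t - \<theta>)))) \<and>
     (\<exists>Rs. is_L2_adjoint (past T) (horizon T) (lag_operator \<alpha> K) Rs) \<and>
     (\<forall>Rs. is_L2_adjoint (past T) (horizon T) (lag_operator \<alpha> K) Rs \<longrightarrow>
        (\<forall>Q\<in>L2_space (horizon T).
           (AE u in past T.
              integrable (tv_measure half_line \<alpha>)
                (\<lambda>\<theta>. indicator {0..T} (u + \<theta>) *\<^sub>R
                       adjoint (blinfun_apply (K (u + \<theta>) \<theta>)) (Q (u + \<theta>))) \<and>
              Rs Q u = signed_integral half_line \<alpha>
                (\<lambda>\<theta>. indicator {0..T} (u + \<theta>) *\<^sub>R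
                       adjoint (blinfun_apply (K (u + \<theta>) \<theta>)) (Q (u + \<theta>)))) \<and>
           (L2_norm (past T) (Rs Q))\<^sup>2
             \<le> enn2real (lag_M0 T \<alpha> K) * enn2real (lag_M T \<alpha> K) * (L2_norm (horizon T) Q)\<^sup>2))"
proof -
  interpret finite_lag_kernel T \<alpha> K
    using assms by unfold_locales (auto simp: lag_kernel_def)
  have "(AE u in past T.
           integrable \<mu> (\<lambda>\<theta>. indicator {0..T} (u + \<theta>) *\<^sub>R
             adjoint (blinfun_apply (K (u + \<theta>) \<theta>)) (Q (u + \<theta>))) \<and>
           Rs Q u = signed_integral half_line \<alpha> (\<lambda>\<theta>. indicator {0..T} (u + \<theta>) *\<^sub>R
             adjoint (blinfun_apply (K (u + \<theta>) \<theta>)) (Q (u + \<theta>)))) \<and>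
        (L2_norm (past T) (Rs Q))\<^sup>2 \<le> M0 * M1 * (L2_norm (horizon T) Q)\<^sup>2"
    if Rs: "is_L2_adjoint (past T) (horizon T) (lag_operator \<alpha> K) Rs" and Q: "Q \<in> L2_space (horizon T)"
    for Rs Q
  proof
    have eq: "AE u in past T. Rs Q u = lag_adjoint T \<alpha> K Q u"
      by (rule L2_adjoint_unique[OF Rs is_L2_adjoint_lag_adjoint Q])
    show "AE u in past T.
           integrable \<mu> (\<lambda>\<theta>. indicator {0..T} (u + \<theta>) *\<^sub>R
             adjoint (blinfun_apply (K (u + \<theta>) \<theta>)) (Q (u + \<theta>))) \<and>
           Rs Q u = signed_integral half_line \<alpha> (\<lambda>\<theta>. indicator {0..T} (u + \<theta>) *\<^sub>R
             adjoint (blinfun_apply (K (u + \<theta>) \<theta>)) (Q (u + \<theta>)))"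
      using AE_lag_adjoint_integrable[OF Q] eq unfolding lag_adjoint_def by (rule AE_conjI)
    have "Rs Q \<in> L2_space (past T)" "lag_adjoint T \<alpha> K Q \<in> L2_space (past T)"
      using Rs L2_bounded_linear_lag_adjoint Q by (auto simp: is_L2_adjoint_def L2_bounded_linear_def)
    then have "L2_norm (past T) (Rs Q) = L2_norm (past T) (lag_adjoint T \<alpha> K Q)"
      using eq by (intro L2_norm_cong_AE L2_space_measurable)
    then show "(L2_norm (past T) (Rs Q))\<^sup>2 \<le> M0 * M1 * (L2_norm (horizon T) Q)\<^sup>2"
      using L2_norm_lag_adjoint_power2_le[OF Q] by simp
  qed
  then show ?thesis
    using L2_bounded_linear_lag_operator AE_lag_operator_integrable is_L2_adjoint_lag_adjoint by blast
qed

end
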